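(* Let $n\geq 2$. The isomorphism relation on countable linear orders is Borel reducible to the conjugacy relation on $\mathrm{Aut}(S(n))$. Hence the conjugacy relation on $\mathrm{Aut}(S(n))$ is Borel complete.
   Context: Fix a countable dense subset $D$ of the unit circle in $\mathbb{C}$ such that for all distinct $x,y\in D$ neither $\arg(x)$ nor $\arg(x/y)$ is a rational multiple of $\pi$ (arguments taken in $[0,2\pi)$). For $n\geq 2$, $S(n)$ is the structure on $D$ with $n$ binary relations $\to_0,\dots,\to_{n-1}$, where $x\to_k y$ iff $\arg(x/y)\in(2\pi k/n,2\pi(k+1)/n)$. $\mathrm{Aut}(S(n))$ is its automorphism group, and the conjugacy relation identifies $\phi,\psi$ iff $\psi=\delta\phi\delta^{-1}$ for some $\delta\in\mathrm{Aut}(S(n))$. The isomorphism relation on countable linear orders is considered on the standard Borel space of linear orders on $\mathbb{N}$. For equivalence relations $E,F$ on standard Borel spaces $X,Y$, $E\leq_B F$ (Borel reducible) means there is a Borel $f\colon X\to Y$ with $x\mathrel{E}x'\iff f(x)\mathrel{F}f(x')$. $E$ is Borel complete if for every countable relational language $\mathcal{L}$ and every Borel class $C$ of $\mathcal{L}$-structures on $\mathbb{N}$, isomorphism on $C$ is Borel reducible to $E$. *)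

theory Defs
  imports "HOL-Analysis.Analysis" "HOL-Algebra.Bij"
begin

section \<open>Borel reducibility\<close>

text \<open>
  Borel spaces are given as measurable spaces (only \<^term>\<open>space M\<close> and \<^term>\<open>sets M\<close> matter, the
  measure is irrelevant).  The spaces used below are Borel subspaces of countable
  products of countable discrete spaces, hence standard.
\<close>

definition borel_reducible ::
    "'a measure \<Rightarrow> ('a \<times> 'a) set \<Rightarrow> 'b measure \<Rightarrow> ('b \<times> 'b) set \<Rightarrow> bool" where
  "borel_reducible M E N F \<longleftrightarrow>
     (\<exists>f \<in> measurable M N. \<forall>x \<in> space M. \<forall>x' \<in> space M. (x, x') \<in> E \<longleftrightarrow> (f x, f x') \<in> F)"


section \<open>Countable relational structures on the natural numbers\<close>

text \<open>
  A relational language is a set \<open>L\<close> of symbols with an arity function \<open>ar\<close>.  A structure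
  with universe \<open>\<nat>\<close> is the family of its truth values \<open>A (r, xs)\<close>, for \<open>r \<in> L\<close> and
  \<open>xs\<close> a tuple of length \<open>ar r\<close>.
\<close>

definition atoms :: "'s set \<Rightarrow> ('s \<Rightarrow> nat) \<Rightarrow> ('s \<times> nat list) set" where
  "atoms L ar = (SIGMA r : L. {xs. length xs = ar r})"

definition structures :: "'s set \<Rightarrow> ('s \<Rightarrow> nat) \<Rightarrow> ('s \<times> nat list \<Rightarrow> bool) measure" where
  "structures L ar = PiM (atoms L ar) (\<lambda>_. count_space UNIV)"

definition isomorphism ::
    "'s set \<Rightarrow> ('s \<Rightarrow> nat) \<Rightarrow> ('s \<times> nat list \<Rightarrow> bool) set
      \<Rightarrow> (('s \<times> nat list \<Rightarrow> bool) \<times> ('s \<times> nat list \<Rightarrow> bool)) set" where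
  "isomorphism L ar C =
     {(A, B). A \<in> C \<and> B \<in> C \<and>
        (\<exists>f :: nat \<Rightarrow> nat. bij f \<and> (\<forall>(r, xs) \<in> atoms L ar. A (r, xs) \<longleftrightarrow> B (r, map f xs)))}"

text \<open>
  The type argument is the type of the relation symbols.
\<close>

definition borel_complete :: "'s itself \<Rightarrow> 'a measure \<Rightarrow> ('a \<times> 'a) set \<Rightarrow> bool" where
  "borel_complete _ N F \<longleftrightarrow>
     (\<forall>(L :: 's set) ar. countable L \<longrightarrow>
        (\<forall>C \<in> sets (structures L ar).
           borel_reducible (restrict_space (structures L ar) C) (isomorphism L ar C) N F))"

text \<open>
  Linear orders (reflexive) on \<open>\<nat>\<close>, as structures in the language with a single binary symbol.
\<close>

definition linear_orders :: "(unit \<times> nat list \<Rightarrow> bool) set" where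
  "linear_orders =
     {A \<in> space (structures UNIV (\<lambda>_. 2)). linear_order_on UNIV {(x, y). A ((), [x, y])}}"

definition linear_order_space :: "(unit \<times> nat list \<Rightarrow> bool) measure" where
  "linear_order_space = restrict_space (structures UNIV (\<lambda>_. 2)) linear_orders"

definition linear_order_isomorphism ::
    "((unit \<times> nat list \<Rightarrow> bool) \<times> (unit \<times> nat list \<Rightarrow> bool)) set" where
  "linear_order_isomorphism = isomorphism UNIV (\<lambda>_. 2) linear_orders"


section \<open>The structures \<open>S(n)\<close> and their automorphism groups\<close>

definition generic_dense_set :: "complex set \<Rightarrow> bool" where
  "generic_dense_set D \<longleftrightarrow>
     countable D \<and> D \<subseteq> sphere 0 1 \<and> sphere 0 1 \<subseteq> closure D \<and>
     (\<forall>x \<in> D. \<forall>y \<in> D. x \<noteq> y \<longrightarrow>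
        \<not> (\<exists>q \<in> \<rat>. Arg2pi x = q * pi) \<and> \<not> (\<exists>q \<in> \<rat>. Arg2pi (x / y) = q * pi))"

definition S_arrow :: "nat \<Rightarrow> nat \<Rightarrow> complex \<Rightarrow> complex \<Rightarrow> bool" where
  "S_arrow n k x y \<longleftrightarrow>
     Arg2pi (x / y) \<in> {2 * pi * real k / real n <..< 2 * pi * real (k + 1) / real n}"

definition Aut_S :: "complex set \<Rightarrow> nat \<Rightarrow> (complex \<Rightarrow> complex) monoid" where
  "Aut_S D n = (BijGroup D)
     \<lparr>carrier := {\<phi> \<in> Bij D.
        \<forall>k < n. \<forall>x \<in> D. \<forall>y \<in> D. S_arrow n k x y \<longleftrightarrow> S_arrow n k (\<phi> x) (\<phi> y)}\<rparr>"

text \<open>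
  The Borel structure of the topology of pointwise convergence, with \<open>D\<close> discrete
  (see \<open>sets_Aut_S_space\<close> below).
\<close>

definition Aut_S_space :: "complex set \<Rightarrow> nat \<Rightarrow> (complex \<Rightarrow> complex) measure" where
  "Aut_S_space D n = restrict_space (PiM D (\<lambda>_. count_space D)) (carrier (Aut_S D n))"

definition conjugacy :: "('g, 'm) monoid_scheme \<Rightarrow> ('g \<times> 'g) set" where
  "conjugacy G =
     {(\<phi>, \<psi>). \<phi> \<in> carrier G \<and> \<psi> \<in> carrier G \<and>
        (\<exists>\<delta> \<in> carrier G. \<psi> = \<delta> \<otimes>\<^bsub>G\<^esub> \<phi> \<otimes>\<^bsub>G\<^esub> inv\<^bsub>G\<^esub> \<delta>)}"


section \<open>Basic facts\<close>

lemma carrier_Aut_S: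
  "carrier (Aut_S D n) = {\<phi> \<in> Bij D.
     \<forall>k < n. \<forall>x \<in> D. \<forall>y \<in> D. S_arrow n k x y \<longleftrightarrow> S_arrow n k (\<phi> x) (\<phi> y)}"
  by (simp add: Aut_S_def)

lemma subgroup_Aut_S: "subgroup (carrier (Aut_S D n)) (BijGroup D)"
proof
  show "carrier (Aut_S D n) \<subseteq> carrier (BijGroup D)"
    by (auto simp: carrier_Aut_S BijGroup_def)
next
  fix f g assume fg: "f \<in> carrier (Aut_S D n)" "g \<in> carrier (Aut_S D n)"
  then have "f \<in> Bij D" "g \<in> Bij D" by (auto simp: carrier_Aut_S)
  moreover have "g x \<in> D" if "x \<in> D" for x
    using Bij_imp_funcset[OF \<open>g \<in> Bij D\<close>] that by auto
  ultimately show "f \<otimes>\<^bsub>BijGroup D\<^esub> g \<in> carrier (Aut_S D n)"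
    using fg by (simp add: carrier_Aut_S BijGroup_def compose_Bij compose_eq)
next
  show "\<one>\<^bsub>BijGroup D\<^esub> \<in> carrier (Aut_S D n)"
    by (simp add: carrier_Aut_S BijGroup_def id_Bij)
next
  fix f assume f: "f \<in> carrier (Aut_S D n)"
  then have fB: "f \<in> Bij D" by (auto simp: carrier_Aut_S)
  then have "f ` D = D" by (simp add: Bij_def bij_betw_def)
  then have "S_arrow n k x y \<longleftrightarrow> S_arrow n k (inv_into D f x) (inv_into D f y)"
    if "k < n" "x \<in> D" "y \<in> D" for k x y
    using f that inv_into_into[of x f D] inv_into_into[of y f D]
      f_inv_into_f[of x f D] f_inv_into_f[of y f D]
    by (simp add: carrier_Aut_S)
  then show "inv\<^bsub>BijGroup D\<^esub> f \<in> carrier (Aut_S D n)"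
    using fB by (simp add: carrier_Aut_S inv_BijGroup restrict_inv_into_Bij)
qed

lemma group_Aut_S: "group (Aut_S D n)"
proof -
  have "Aut_S D n = (BijGroup D)\<lparr>carrier := carrier (Aut_S D n)\<rparr>"
    by (simp add: Aut_S_def)
  then show ?thesis
    using subgroup.subgroup_is_group[OF subgroup_Aut_S group_BijGroup, of D n] by simp
qed

lemma equiv_conjugacy:
  assumes "group G" shows "equiv (carrier G) (conjugacy G)"
proof -
  interpret group G by fact
  show ?thesis
  proof (rule equivI)
    show "conjugacy G \<subseteq> carrier G \<times> carrier G"
      by (auto simp: conjugacy_def)
    show "refl_on (carrier G) (conjugacy G)"
      unfolding refl_on_def conjugacy_def
      by (auto intro!: bexI[of _ "\<one>\<^bsub>G\<^esub>"])
    show "sym (conjugacy G)"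
    proof (rule symI)
      fix a b assume "(a, b) \<in> conjugacy G"
      then obtain d where d: "a \<in> carrier G" "b \<in> carrier G" "d \<in> carrier G"
        "b = d \<otimes>\<^bsub>G\<^esub> a \<otimes>\<^bsub>G\<^esub> inv\<^bsub>G\<^esub> d" by (auto simp: conjugacy_def)
      then have "b \<otimes>\<^bsub>G\<^esub> d = d \<otimes>\<^bsub>G\<^esub> a"
        by (simp add: m_assoc)
      then have "inv\<^bsub>G\<^esub> d \<otimes>\<^bsub>G\<^esub> (b \<otimes>\<^bsub>G\<^esub> d) = a"
        using d by (metis inv_closed l_inv l_one m_assoc)
      then have "a = inv\<^bsub>G\<^esub> d \<otimes>\<^bsub>G\<^esub> b \<otimes>\<^bsub>G\<^esub> inv\<^bsub>G\<^esub> (inv\<^bsub>G\<^esub> d)"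
        using d(1-3) by (simp add: m_assoc)
      with d(1-3) show "(b, a) \<in> conjugacy G"
        unfolding conjugacy_def by blast
    qed
    show "trans (conjugacy G)"
    proof (rule transI)
      fix a b c assume "(a, b) \<in> conjugacy G" "(b, c) \<in> conjugacy G"
      then obtain d e where d: "a \<in> carrier G" "c \<in> carrier G" "d \<in> carrier G" "e \<in> carrier G"
        "b = d \<otimes>\<^bsub>G\<^esub> a \<otimes>\<^bsub>G\<^esub> inv\<^bsub>G\<^esub> d" "c = e \<otimes>\<^bsub>G\<^esub> b \<otimes>\<^bsub>G\<^esub> inv\<^bsub>G\<^esub> e"
        by (auto simp: conjugacy_def)
      then have "c = (e \<otimes>\<^bsub>G\<^esub> d) \<otimes>\<^bsub>G\<^esub> a \<otimes>\<^bsub>G\<^esub> inv\<^bsub>G\<^esub> (e \<otimes>\<^bsub>G\<^esub> d)"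
        by (simp add: m_assoc inv_mult_group)
      with d show "(a, c) \<in> conjugacy G"
        unfolding conjugacy_def by blast
    qed
  qed
qed

lemma map_in_atoms: "(r, map f xs) \<in> atoms L ar \<longleftrightarrow> (r, xs) \<in> atoms L ar"
  by (auto simp: atoms_def)

lemma equiv_isomorphism: "equiv C (isomorphism L ar C)"
proof (rule equivI)
  show "isomorphism L ar C \<subseteq> C \<times> C"
    by (auto simp: isomorphism_def)
  show "refl_on C (isomorphism L ar C)"
    by (auto simp: refl_on_def isomorphism_def intro!: exI[of _ id])
  show "sym (isomorphism L ar C)"
  proof (rule symI)
    fix A B assume "(A, B) \<in> isomorphism L ar C"
    then obtain f where f: "A \<in> C" "B \<in> C" "bij f"
      "\<And>r xs. (r, xs) \<in> atoms L ar \<Longrightarrow> A (r, xs) \<longleftrightarrow> B (r, map f xs)"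
      by (auto simp: isomorphism_def)
    have "B (r, xs) \<longleftrightarrow> A (r, map (inv_into UNIV f) xs)" if "(r, xs) \<in> atoms L ar" for r xs
    proof -
      have "map f (map (inv_into UNIV f) xs) = xs"
        using f(3) by (simp add: bij_is_surj o_def surj_f_inv_f)
      then show ?thesis
        using f(4)[of r "map (inv_into UNIV f) xs"] that by (simp only: map_in_atoms)
    qed
    then show "(B, A) \<in> isomorphism L ar C"
      using f bij_imp_bij_inv[OF f(3)] by (auto simp: isomorphism_def)
  qed
  show "trans (isomorphism L ar C)"
  proof (rule transI)
    fix A B B' assume "(A, B) \<in> isomorphism L ar C" "(B, B') \<in> isomorphism L ar C"
    then obtain f g where f: "A \<in> C" "B' \<in> C" "bij f" "bij g"
      "\<forall>(r, xs) \<in> atoms L ar. A (r, xs) \<longleftrightarrow> B (r, map f xs)"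
      "\<forall>(r, xs) \<in> atoms L ar. B (r, xs) \<longleftrightarrow> B' (r, map g xs)"
      unfolding isomorphism_def by blast
    have "A (r, xs) \<longleftrightarrow> B' (r, map (g \<circ> f) xs)" if "(r, xs) \<in> atoms L ar" for r xs
    proof -
      have "A (r, xs) \<longleftrightarrow> B (r, map f xs)"
        using f(5) that by blast
      moreover have "B (r, map f xs) \<longleftrightarrow> B' (r, map g (map f xs))"
        using f(6) that map_in_atoms by fast
      ultimately show ?thesis by simp
    qed
    then show "(A, B') \<in> isomorphism L ar C"
      using f(1,2) bij_comp[OF f(3,4)] unfolding isomorphism_def by blast
  qed
qed

lemma sets_PiM_discrete:
  assumes I: "countable I" and X: "\<And>i. i \<in> I \<Longrightarrow> countable (X i)"
  shows "sets (PiM I (\<lambda>i. count_space (X i))) =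
    sigma_sets (PiE I X) {U. openin (product_topology (\<lambda>i. discrete_topology (X i)) I) U}"
    (is "?L = sigma_sets ?S {U. openin ?T U}")
proof
  have top: "topspace ?T = ?S" by simp
  have sub: "{U. openin ?T U} \<subseteq> Pow ?S"
    using openin_subset[of ?T] top by auto
  show "?L \<subseteq> sigma_sets ?S {U. openin ?T U}"
    unfolding sets_PiM_single space_count_space
  proof (rule sigma_sets_mono, safe)
    fix i A assume i: "i \<in> I" and A: "A \<in> sets (count_space (X i))"
    have "continuous_map ?T (discrete_topology (X i)) (\<lambda>f. f i)"
      using continuous_map_product_projection[OF i, of "\<lambda>i. discrete_topology (X i)"] .
    then have "openin ?T {f \<in> topspace ?T. f i \<in> A}"
      using A by (intro openin_continuous_map_preimage) auto
    then show "{f \<in> \<Pi>\<^sub>E i\<in>I. X i. f i \<in> A} \<in> sigma_sets ?S {U. openin ?T U}"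
      by (auto simp: top intro!: sigma_sets.Basic)
  qed
  have "U \<in> ?L" if U: "openin ?T U" for U
  proof -
    define cyl where "cyl = (\<lambda>(F, g). {f \<in> ?S. \<forall>i \<in> F. f i = g i})"
    define K where "K = (SIGMA F : {F. finite F \<and> F \<subseteq> I}. PiE F X)"
    have cyl: "cyl p \<in> ?L" if "p \<in> K" for p
    proof -
      obtain F g where Fg: "p = (F, g)" by (cases p)
      with that have p: "p = (F, g)" "finite F" "F \<subseteq> I" "g \<in> PiE F X"
        by (auto simp: K_def)
      have "{f \<in> space (PiM I (\<lambda>i. count_space (X i))). \<forall>i \<in> F. f i = g i} \<in> ?L"
      proof (rule sets.sets_Collect_finite_All[OF _ p(2)])
        fix i assume "i \<in> F"
        then have "(\<lambda>f. f i) \<in> measurable (PiM I (\<lambda>i. count_space (X i))) (count_space (X i))"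
          "{g i} \<in> sets (count_space (X i))"
          using p by (auto intro!: measurable_component_singleton)
        then have "(\<lambda>f. f i) -` {g i} \<inter> space (PiM I (\<lambda>i. count_space (X i))) \<in> ?L"
          by (rule measurable_sets)
        moreover have "(\<lambda>f. f i) -` {g i} \<inter> space (PiM I (\<lambda>i. count_space (X i))) =
          {f \<in> space (PiM I (\<lambda>i. count_space (X i))). f i = g i}" by auto
        ultimately show "{f \<in> space (PiM I (\<lambda>i. count_space (X i))). f i = g i} \<in> ?L" by simp
      qed
      then show ?thesis by (simp add: p cyl_def space_PiM)
    qed
    have "countable K"
      unfolding K_def using I X
      by (intro countable_SIGMA countable_PiE) (auto intro: countable_Collect_finite_subset)
    then have "(\<Union>p \<in> {p \<in> K. cyl p \<subseteq> U}. cyl p) \<in> ?L"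
      by (intro sets.countable_UN') (auto intro: cyl countable_subset[of _ K])
    moreover have "(\<Union>p \<in> {p \<in> K. cyl p \<subseteq> U}. cyl p) = U"
    proof
      show "U \<subseteq> (\<Union>p \<in> {p \<in> K. cyl p \<subseteq> U}. cyl p)"
      proof
        fix x assume x: "x \<in> U"
        then have xS: "x \<in> ?S" using U sub by auto
        obtain V where V: "finite {i \<in> I. V i \<noteq> X i}" "x \<in> PiE I V" "PiE I V \<subseteq> U"
          using U x unfolding openin_product_topology_alt by force
        define F where "F = {i \<in> I. V i \<noteq> X i}"
        have "(F, restrict x F) \<in> K"
          using V(1) xS by (auto simp: K_def F_def)
        moreover have "cyl (F, restrict x F) \<subseteq> U"
        proof
          fix f assume f: "f \<in> cyl (F, restrict x F)"
          have "f i \<in> V i" if "i \<in> I" for i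
            using f V(2) that by (cases "i \<in> F") (auto simp: cyl_def F_def PiE_iff)
          then have "f \<in> PiE I V"
            using f by (auto simp: cyl_def PiE_iff)
          then show "f \<in> U" using V(3) by auto
        qed
        moreover have "x \<in> cyl (F, restrict x F)"
          using xS by (auto simp: cyl_def)
        ultimately show "x \<in> (\<Union>p \<in> {p \<in> K. cyl p \<subseteq> U}. cyl p)" by blast
      qed
    qed auto
    ultimately show ?thesis by simp
  qed
  moreover have "?S = space (PiM I (\<lambda>i. count_space (X i)))"
    by (simp add: space_PiM)
  ultimately show "sigma_sets ?S {U. openin ?T U} \<subseteq> ?L"
    by (metis (no_types, lifting) mem_Collect_eq sets.sigma_sets_subset subsetI)
qed

lemma sets_restrict_PiM_discrete:
  assumes "countable I" "\<And>i. i \<in> I \<Longrightarrow> countable (X i)" and Om: "\<Omega> \<subseteq> PiE I X"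
  shows "sets (restrict_space (PiM I (\<lambda>i. count_space (X i))) \<Omega>) =
    sigma_sets \<Omega> {U. openin (subtopology (product_topology (\<lambda>i. discrete_topology (X i)) I) \<Omega>) U}"
proof -
  let ?T = "product_topology (\<lambda>i. discrete_topology (X i)) I"
  have eq: "sets (PiM I (\<lambda>i. count_space (X i))) = sigma_sets (PiE I X) {U. openin ?T U}"
    by (rule sets_PiM_discrete) (use assms in auto)
  have "sets (restrict_space (PiM I (\<lambda>i. count_space (X i))) \<Omega>) =
    {id -` A \<inter> \<Omega> |A. A \<in> sigma_sets (PiE I X) {U. openin ?T U}}"
    unfolding sets_restrict_space eq image_def
    by (simp add: Int_commute Bex_def conj_commute)
  also have "\<dots> = sigma_sets \<Omega> {id -` A \<inter> \<Omega> |A. A \<in> {U. openin ?T U}}"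
    by (rule sigma_sets_vimage_commute) (use Om in \<open>unfold Pi_iff id_apply, blast\<close>)
  also have "{id -` A \<inter> \<Omega> |A. A \<in> {U. openin ?T U}} = {U. openin (subtopology ?T \<Omega>) U}"
    by (auto simp: openin_subtopology)
  finally show ?thesis .
qed

lemma carrier_Aut_S_subset: "carrier (Aut_S D n) \<subseteq> (D \<rightarrow>\<^sub>E D)"
  by (auto simp: carrier_Aut_S Bij_def PiE_def bij_betw_def)

lemma space_Aut_S_space: "space (Aut_S_space D n) = carrier (Aut_S D n)"
  using carrier_Aut_S_subset[of D n]
  by (auto simp: Aut_S_space_def space_restrict_space space_PiM)

lemma sets_Aut_S_space:
  assumes "countable D"
  shows "sets (Aut_S_space D n) = sigma_sets (carrier (Aut_S D n))
    {U. openin (subtopology (product_topology (\<lambda>_. discrete_topology D) D) (carrier (Aut_S D n))) U}"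
  unfolding Aut_S_space_def
  using sets_restrict_PiM_discrete[where I = D and X = "\<lambda>_. D" and \<Omega> = "carrier (Aut_S D n)"]
    assms carrier_Aut_S_subset by blast

end

theory Submission
  imports Defs "HOL-Library.List_Lexorder"
begin

text \<open>
  Cutting the circle into \<open>n\<close> equal arcs and rotating them onto the first one turns \<open>S(n)\<close> into a
  countable dense linear order with \<open>n\<close> dense colour classes, whose order and colours determine the
  relations \<open>\<rightarrow>\<^sub>k\<close>.  Hence every coloured order isomorphic to it, with a colour preserving automorphism,
  yields an element of \<open>Aut(S(n))\<close>, and back-and-forth provides such isomorphisms measurably in the
  order.  For a linear order \<open>K\<close> this is applied to \<open>(1 + K) \<times> \<rat>\<close>, where the automorphism shifts the
  fibre of \<open>1\<close> down and all other fibres up.  A conjugating element of \<open>Aut(S(n))\<close> need not preserve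
  the cut of the circle, but it preserves the fibre of \<open>1\<close>, because only its points are moved down.
  Relative to that fibre the order of the other orbitals can be read off from the relations.

  For an arbitrary structure \<open>A\<close>, the order \<open>K\<close> is taken to be the lexicographic order on finite
  sequences of rationals, with each sequence \<open>s\<close> replaced by a finite block.  The rationals are
  coloured by natural numbers with every colour dense, so \<open>s\<close> names a tuple in \<open>A\<close>, and the size of
  its block codes the finite part of the quantifier-free type of this tuple.  The blocks can be
  recovered from the order since between different blocks there are infinitely many points, the
  tree order on sequences since it is definable from the lexicographic order and the lengths, and \<open>A\<close>
  by a back-and-forth argument along the tree.
\<close>

section \<open>Measurable back-and-forth\<close>

text \<open>\<open>G x\<close> is a family of good finite matchings. Searching for the least code of
  a witness, alternately on the two sides, makes every stage a measurable function of
  \<open>x\<close> with countably many values. The limit \<open>F x\<close> is therefore measurable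
  in the sense that each event "a goes to b" is.\<close>

lemma back_and_forth_measurable:
  fixes A :: "'x \<Rightarrow> 'a::countable set" and B :: "'b::countable set"
    and G :: "'x \<Rightarrow> ('a \<times> 'b) list \<Rightarrow> bool"
  assumes [measurable]: "\<And>a. Measurable.pred M (\<lambda>x. a \<in> A x)" "\<And>p. Measurable.pred M (\<lambda>x. G x p)"
    and nil: "\<And>x. x \<in> space M \<Longrightarrow> G x []"
    and forth: "\<And>x p a. x \<in> space M \<Longrightarrow> G x p \<Longrightarrow> a \<in> A x \<Longrightarrow> \<exists>b. G x ((a, b) # p)"
    and bck: "\<And>x p b. x \<in> space M \<Longrightarrow> G x p \<Longrightarrow> b \<in> B \<Longrightarrow> \<exists>a. G x ((a, b) # p)"
    and sub: "\<And>x p. G x p \<Longrightarrow> set p \<subseteq> A x \<times> B"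
    and inj: "\<And>x p a b a' b'. G x p \<Longrightarrow> (a, b) \<in> set p \<Longrightarrow> (a', b') \<in> set p \<Longrightarrow> a = a' \<longleftrightarrow> b = b'"
  obtains F where "\<And>x. x \<in> space M \<Longrightarrow> bij_betw (F x) (A x) B"
    "\<And>x as. x \<in> space M \<Longrightarrow> finite as \<Longrightarrow> as \<subseteq> A x \<Longrightarrow> \<exists>p. G x p \<and> (\<forall>a\<in>as. (a, F x a) \<in> set p)"
    "\<And>a b. Measurable.pred M (\<lambda>x. a \<in> A x \<and> F x a = b)"
proof -
  \<comment> \<open>The partner is the one with the least code, not an arbitrary choice, so that it
    depends measurably on \<open>x\<close>. Elements outside \<open>A x\<close> leave the matching
    as it is.\<close>
  define fo where "fo x a p = (if a \<in> A x then (a, from_nat (LEAST m. G x ((a, from_nat m) # p))) # p else p)"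
    for x a p
  define ba where "ba x b p = (if b \<in> B then (from_nat (LEAST m. G x ((from_nat m, b) # p)), b) # p else p)"
    for x b p
  define P where "P x = rec_nat [] (\<lambda>k p. ba x (from_nat k) (fo x (from_nat k) p))" for x
  have P0: "P x 0 = []" and PS: "P x (Suc k) = ba x (from_nat k) (fo x (from_nat k) (P x k))" for x k
    by (simp_all add: P_def)
  have fo_meas: "(\<lambda>x. fo x a p) \<in> measurable M (count_space UNIV)" for a p
    unfolding fo_def by measurable
  have ba_meas: "(\<lambda>x. ba x b p) \<in> measurable M (count_space UNIV)" for b p
    unfolding ba_def by measurable
  have [measurable]: "(\<lambda>x. P x k) \<in> measurable M (count_space UNIV)" for k
  proof (induction k)
    case (Suc k)
    have "(\<lambda>x. fo x (from_nat k) (P x k)) \<in> measurable M (count_space UNIV)"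
      \<comment> \<open>The earlier stage takes countably many values, so it suffices to treat each
        fixed value of it.\<close>
      by (rule measurable_compose_countable[OF fo_meas Suc])
    from measurable_compose_countable[OF ba_meas this] show ?case
      unfolding PS .
  qed (simp add: P0)
  have foG: "G x (fo x a p) \<and> set p \<subseteq> set (fo x a p) \<and> (a \<in> A x \<longrightarrow> a \<in> fst ` set (fo x a p))"
    if "x \<in> space M" "G x p" for x a p
  proof (cases "a \<in> A x")
    case True
    from forth[OF that True] obtain b where "G x ((a, b) # p)" by blast
    then have "G x ((a, from_nat (to_nat b)) # p)" by simp
    then have "G x ((a, from_nat (LEAST m. G x ((a, from_nat m) # p))) # p)"
      by (rule LeastI)
    then show ?thesis using True by (auto simp: fo_def)
  qed (use that in \<open>simp add: fo_def\<close>)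
  have baG: "G x (ba x b p) \<and> set p \<subseteq> set (ba x b p) \<and> (b \<in> B \<longrightarrow> b \<in> snd ` set (ba x b p))"
    if "x \<in> space M" "G x p" for x b p
  proof (cases "b \<in> B")
    case True
    from bck[OF that True] obtain a where "G x ((a, b) # p)" by blast
    then have "G x ((from_nat (to_nat a), b) # p)" by simp
    then have "G x ((from_nat (LEAST m. G x ((from_nat m, b) # p)), b) # p)"
      by (rule LeastI)
    then show ?thesis using True by (auto simp: ba_def)
  qed (use that in \<open>simp add: ba_def\<close>)
  have G: "G x (P x k)" if "x \<in> space M" for x k
    by (induction k) (use that nil foG baG in \<open>auto simp: P0 PS\<close>)
  have step: "set (P x k) \<subseteq> set (P x (Suc k))"
      "from_nat k \<in> A x \<longrightarrow> from_nat k \<in> fst ` set (P x (Suc k))"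
      "from_nat k \<in> B \<longrightarrow> from_nat k \<in> snd ` set (P x (Suc k))"
    if "x \<in> space M" for x k
  proof -
    note f = foG[OF that G[OF that], of "from_nat k" k]
    note b = baG[OF that conjunct1[OF f], of "from_nat k"]
    show "set (P x k) \<subseteq> set (P x (Suc k))"
      "from_nat k \<in> A x \<longrightarrow> from_nat k \<in> fst ` set (P x (Suc k))"
      "from_nat k \<in> B \<longrightarrow> from_nat k \<in> snd ` set (P x (Suc k))"
      using f b unfolding PS by blast+
  qed
  have mono: "set (P x k) \<subseteq> set (P x m)" if "x \<in> space M" "k \<le> m" for x k m
    by (rule lift_Suc_mono_le[of "\<lambda>k. set (P x k)"]) (use step that in auto)
  have inj': "a = a' \<longleftrightarrow> b = b'"
    if "x \<in> space M" "(a, b) \<in> set (P x k)" "(a', b') \<in> set (P x m)" for x a b a' b' k m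
  proof -
    have "(a, b) \<in> set (P x (max k m))" "(a', b') \<in> set (P x (max k m))"
      using that mono[OF that(1), of k "max k m"] mono[OF that(1), of m "max k m"] by auto
    then show ?thesis using inj[OF G[OF that(1)]] by blast
  qed
  \<comment> \<open>The union of all stages. By \<open>inj'\<close> it is single-valued, which makes
    the description definite on \<open>A x\<close>.\<close>
  define F where "F x a = (THE b. \<exists>k. (a, b) \<in> set (P x k))" for x a
  have F: "a \<in> A x \<and> F x a = b \<longleftrightarrow> (\<exists>k. (a, b) \<in> set (P x k))" if x: "x \<in> space M" for x a b
  proof
    assume a: "a \<in> A x \<and> F x a = b"
    then obtain b' where "(a, b') \<in> set (P x (Suc (to_nat a)))"
      using step(2)[OF x, of "to_nat a"] by auto
    then have ex: "\<exists>k. (a, b') \<in> set (P x k)" by blast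
    have "F x a = b'"
      unfolding F_def by (rule the_equality) (use ex inj'[OF x] in blast)+
    with ex a show "\<exists>k. (a, b) \<in> set (P x k)" by simp
  next
    assume ex: "\<exists>k. (a, b) \<in> set (P x k)"
    then have "a \<in> A x" using sub[OF G[OF x]] by blast
    moreover have "F x a = b"
      unfolding F_def by (rule the_equality) (use ex inj'[OF x] in blast)+
    ultimately show "a \<in> A x \<and> F x a = b" by simp
  qed
  show ?thesis
  proof
    fix x assume x: "x \<in> space M"
    show "bij_betw (F x) (A x) B"
    proof (rule bij_betw_imageI)
      show "inj_on (F x) (A x)"
        using F[OF x] inj'[OF x] by (metis inj_onI)
      have "F x a \<in> B" if a: "a \<in> A x" for a
        using F[OF x, of a "F x a"] a sub[OF G[OF x]] by blast
      moreover have "b \<in> F x ` A x" if "b \<in> B" for b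
      proof -
        from step(3)[OF x, of "to_nat b"] that
        obtain a where "(a, b) \<in> set (P x (Suc (to_nat b)))" by auto
        then show ?thesis using F[OF x, of a b] by blast
      qed
      ultimately show "F x ` A x = B" by blast
    qed
    fix as :: "'a set" assume "finite as" "as \<subseteq> A x"
    then have "\<exists>k. \<forall>a\<in>as. (a, F x a) \<in> set (P x k)"
    proof (induction as)
      case (insert a as)
      then obtain k m where "\<forall>a\<in>as. (a, F x a) \<in> set (P x k)" "(a, F x a) \<in> set (P x m)"
        using F[OF x, of a "F x a"] by auto
      then show ?case
        using mono[OF x, of k "max k m"] mono[OF x, of m "max k m"]
        by (intro exI[of _ "max k m"]) auto
    qed simp
    then show "\<exists>p. G x p \<and> (\<forall>a\<in>as. (a, F x a) \<in> set p)"
      using G[OF x] by blast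
  next
    fix a b
    \<comment> \<open>The graph of \<open>F x\<close> is a countable union of events about single
      stages.\<close>
    have "Measurable.pred M (\<lambda>x. \<exists>k. (a, b) \<in> set (P x k))"
      by measurable
    then show "Measurable.pred M (\<lambda>x. a \<in> A x \<and> F x a = b)"
      by (subst measurable_cong[OF F])
  qed
qed

section \<open>Coloured dense orders\<close>

definition strict_linear_on :: "'a set \<Rightarrow> ('a \<Rightarrow> 'a \<Rightarrow> bool) \<Rightarrow> bool" where
  "strict_linear_on A lt \<longleftrightarrow> irreflp_on A lt \<and> transp_on A lt \<and> totalp_on A lt"

lemma strict_linear_on_asym:
  assumes "strict_linear_on A lt" "a \<in> A" "b \<in> A" "lt a b" shows "\<not> lt b a"
  using assms unfolding strict_linear_on_def irreflp_on_def transp_on_def by blast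

lemma strict_linear_on_trans:
  "strict_linear_on A lt \<Longrightarrow> a \<in> A \<Longrightarrow> b \<in> A \<Longrightarrow> c \<in> A \<Longrightarrow> lt a b \<Longrightarrow> lt b c \<Longrightarrow> lt a c"
  unfolding strict_linear_on_def transp_on_def by blast

lemma strict_linear_on_irrefl: "strict_linear_on A lt \<Longrightarrow> a \<in> A \<Longrightarrow> \<not> lt a a"
  unfolding strict_linear_on_def irreflp_on_def by blast

lemma strict_linear_on_total:
  "strict_linear_on A lt \<Longrightarrow> a \<in> A \<Longrightarrow> b \<in> A \<Longrightarrow> lt a b \<or> a = b \<or> lt b a"
  unfolding strict_linear_on_def totalp_on_def by blast

lemma strict_linear_on_flip:
  assumes "strict_linear_on A lt" shows "strict_linear_on A (\<lambda>a b. lt b a)"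
  unfolding strict_linear_on_def
proof (intro conjI)
  show "irreflp_on A (\<lambda>a b. lt b a)"
    by (rule irreflp_onI) (rule strict_linear_on_irrefl[OF assms])
  show "transp_on A (\<lambda>a b. lt b a)"
    by (rule transp_onI) (rule strict_linear_on_trans[OF assms])
  show "totalp_on A (\<lambda>a b. lt b a)"
    by (rule totalp_onI) (use strict_linear_on_total[OF assms] in blast)
qed

lemma strict_linear_on_less: "strict_linear_on A ((<) :: 'a::linorder \<Rightarrow> _)"
  unfolding strict_linear_on_def irreflp_on_def totalp_on_def transp_on_def by auto

lemma strict_linear_on_finite_max:
  assumes "strict_linear_on A lt" "finite S" "S \<noteq> {}" "S \<subseteq> A"
  shows "\<exists>m\<in>S. \<forall>s\<in>S. s = m \<or> lt s m"
  using assms(2-4)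
proof (induction S rule: finite_ne_induct)
  case (insert a S)
  then obtain m where m: "m \<in> S" "\<forall>s\<in>S. s = m \<or> lt s m" by auto
  consider "lt a m" | "a = m" | "lt m a"
    using strict_linear_on_total[OF assms(1), of a m] m insert.prems by blast
  then show ?case
  proof cases
    case 3
    have "lt s a" if "s \<in> S" for s
      using m insert.prems 3 that strict_linear_on_trans[OF assms(1), of s m a]
      by (cases "s = m") auto
    then show ?thesis by blast
  qed (use m in auto)
qed simp

text \<open>This is the extension property used by one back-and-forth step. Taking \<open>S\<close>
  or \<open>T\<close> empty also gives nonemptiness and the absence of end points when there are
  colours.\<close>

definition dense_coloured ::
    "'a set \<Rightarrow> ('a \<Rightarrow> 'a \<Rightarrow> bool) \<Rightarrow> ('a \<Rightarrow> 'c) \<Rightarrow> 'c set \<Rightarrow> bool" where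
  "dense_coloured A lt col Cs \<longleftrightarrow> strict_linear_on A lt \<and> col ` A \<subseteq> Cs \<and>
     (\<forall>S T k. finite S \<longrightarrow> finite T \<longrightarrow> S \<subseteq> A \<longrightarrow> T \<subseteq> A \<longrightarrow> (\<forall>s\<in>S. \<forall>t\<in>T. lt s t) \<longrightarrow> k \<in> Cs \<longrightarrow>
        (\<exists>z\<in>A. col z = k \<and> (\<forall>s\<in>S. lt s z) \<and> (\<forall>t\<in>T. lt z t)))"

lemma dense_colouredD:
  assumes "dense_coloured A lt col Cs" "finite S" "finite T" "S \<subseteq> A" "T \<subseteq> A"
    "\<And>s t. s \<in> S \<Longrightarrow> t \<in> T \<Longrightarrow> lt s t" "k \<in> Cs"
  obtains z where "z \<in> A" "col z = k" "\<And>s. s \<in> S \<Longrightarrow> lt s z" "\<And>t. t \<in> T \<Longrightarrow> lt z t"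
proof -
  have "\<exists>z\<in>A. col z = k \<and> (\<forall>s\<in>S. lt s z) \<and> (\<forall>t\<in>T. lt z t)"
    using assms unfolding dense_coloured_def by simp
  then show ?thesis using that by auto
qed

text \<open>Of the finite sets \<open>S\<close> and \<open>T\<close> only the maximum of
  \<open>S\<close> and the minimum of \<open>T\<close> matter, which leaves four cases according to
  which of the two sets are empty.\<close>

lemma dense_colouredI:
  assumes lin: "strict_linear_on A lt" and col: "col ` A \<subseteq> Cs"
    and mid: "\<And>a b k. a \<in> A \<Longrightarrow> b \<in> A \<Longrightarrow> lt a b \<Longrightarrow> k \<in> Cs \<Longrightarrow> \<exists>z\<in>A. col z = k \<and> lt a z \<and> lt z b"
    and above: "\<And>a k. a \<in> A \<Longrightarrow> k \<in> Cs \<Longrightarrow> \<exists>z\<in>A. col z = k \<and> lt a z"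
    and below: "\<And>a k. a \<in> A \<Longrightarrow> k \<in> Cs \<Longrightarrow> \<exists>z\<in>A. col z = k \<and> lt z a"
    and ne: "A \<noteq> {}"
  shows "dense_coloured A lt col Cs"
  unfolding dense_coloured_def
proof (intro conjI allI impI)
  fix S T k
  assume S: "finite S" "S \<subseteq> A" and T: "finite T" "T \<subseteq> A" and ST: "\<forall>s\<in>S. \<forall>t\<in>T. lt s t" and k: "k \<in> Cs"
  have maxS: "\<exists>m\<in>S. \<forall>s\<in>S. s = m \<or> lt s m" if "S \<noteq> {}"
    using strict_linear_on_finite_max[OF lin S(1) that S(2)] .
  have minT: "\<exists>m\<in>T. \<forall>t\<in>T. t = m \<or> lt m t" if "T \<noteq> {}"
    using strict_linear_on_finite_max[OF strict_linear_on_flip[OF lin] T(1) that T(2)] .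
  have S_lt: "\<forall>s\<in>S. lt s z" if "m \<in> S" "\<forall>s\<in>S. s = m \<or> lt s m" "lt m z" "z \<in> A" for m z
    using that S(2) strict_linear_on_trans[OF lin, of _ m z] by (metis subsetD)
  have T_lt: "\<forall>t\<in>T. lt z t" if "m \<in> T" "\<forall>t\<in>T. t = m \<or> lt m t" "lt z m" "z \<in> A" for m z
    using that T(2) strict_linear_on_trans[OF lin, of z m] by (metis subsetD)
  consider "S = {}" "T = {}" | "S \<noteq> {}" "T = {}" | "S = {}" "T \<noteq> {}" | "S \<noteq> {}" "T \<noteq> {}"
    by blast
  then show "\<exists>z\<in>A. col z = k \<and> (\<forall>s\<in>S. lt s z) \<and> (\<forall>t\<in>T. lt z t)"
  proof cases
    case 1
    then show ?thesis using ne above[OF _ k] by blast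
  next
    case 2
    then obtain m where m: "m \<in> S" "\<forall>s\<in>S. s = m \<or> lt s m" using maxS by blast
    then obtain z where "z \<in> A" "col z = k" "lt m z" using above[OF _ k, of m] S(2) by blast
    then show ?thesis using S_lt[OF m] 2 by blast
  next
    case 3
    then obtain m where m: "m \<in> T" "\<forall>t\<in>T. t = m \<or> lt m t" using minT by blast
    then obtain z where "z \<in> A" "col z = k" "lt z m" using below[OF _ k, of m] T(2) by blast
    then show ?thesis using T_lt[OF m] 3 by blast
  next
    case 4
    then obtain m m' where m: "m \<in> S" "\<forall>s\<in>S. s = m \<or> lt s m" and m': "m' \<in> T" "\<forall>t\<in>T. t = m' \<or> lt m' t"
      using maxS minT by blast
    then obtain z where "z \<in> A" "col z = k" "lt m z" "lt z m'"
      using mid[OF _ _ _ k, of m m'] S(2) T(2) ST by blast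
    then show ?thesis using S_lt[OF m] T_lt[OF m'] by blast
  qed
qed fact+

section \<open>Finite partial isomorphisms and their extension\<close>

definition partial_iso ::
    "'a set \<Rightarrow> ('a \<Rightarrow> 'a \<Rightarrow> bool) \<Rightarrow> ('a \<Rightarrow> 'c) \<Rightarrow> 'b set \<Rightarrow> ('b \<Rightarrow> 'b \<Rightarrow> bool) \<Rightarrow> ('b \<Rightarrow> 'c)
      \<Rightarrow> ('a \<times> 'b) list \<Rightarrow> bool" where
  "partial_iso A ltA colA B ltB colB p \<longleftrightarrow>
     (\<forall>(a, b)\<in>set p. a \<in> A \<and> b \<in> B \<and> colA a = colB b \<and>
        (\<forall>(a', b')\<in>set p. (ltA a a' \<longleftrightarrow> ltB b b') \<and> (a = a' \<longleftrightarrow> b = b')))"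

lemma partial_isoD:
  assumes p: "partial_iso A ltA colA B ltB colB p" and u: "(a, b) \<in> set p" and v: "(a', b') \<in> set p"
  shows "a \<in> A \<and> b \<in> B \<and> colA a = colB b \<and> (ltA a a' \<longleftrightarrow> ltB b b') \<and> (a = a' \<longleftrightarrow> b = b')"
proof -
  have "case (a, b) of (a, b) \<Rightarrow> a \<in> A \<and> b \<in> B \<and> colA a = colB b \<and>
      (\<forall>(a', b')\<in>set p. (ltA a a' \<longleftrightarrow> ltB b b') \<and> (a = a' \<longleftrightarrow> b = b'))"
    using p u unfolding partial_iso_def by (rule bspec)
  then show ?thesis using v by auto
qed

lemma partial_iso_Cons:
  "partial_iso A ltA colA B ltB colB ((a, b) # p) \<longleftrightarrow>
     partial_iso A ltA colA B ltB colB p \<and> a \<in> A \<and> b \<in> B \<and> colA a = colB b \<and> (ltA a a \<longleftrightarrow> ltB b b) \<and>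
     (\<forall>(a', b')\<in>set p. (ltA a a' \<longleftrightarrow> ltB b b') \<and> (ltA a' a \<longleftrightarrow> ltB b' b) \<and> a \<noteq> a' \<and> b \<noteq> b' \<or>
        a = a' \<and> b = b')"
  unfolding partial_iso_def by (simp add: split_def ball_conj_distrib) fastforce

lemma partial_iso_swap:
  "partial_iso A ltA colA B ltB colB p \<longleftrightarrow> partial_iso B ltB colB A ltA colA (map prod.swap p)"
  unfolding partial_iso_def by auto

text \<open>The partners of the points below \<open>a\<close> and those of the points above
  \<open>a\<close> form finite sets \<open>S\<close> and \<open>T\<close> with \<open>S\<close>
  below \<open>T\<close>. Density of the colour of \<open>a\<close> gives a partner between
  them.\<close>

lemma partial_iso_forth:
  assumes A: "dense_coloured A ltA colA Cs" and B: "dense_coloured B ltB colB Cs"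
    and p: "partial_iso A ltA colA B ltB colB p" and a: "a \<in> A"
  shows "\<exists>b. partial_iso A ltA colA B ltB colB ((a, b) # p)"
proof (cases "a \<in> fst ` set p")
  case True
  \<comment> \<open>A point that is matched already may be asked for again. Repeating its pair
    changes nothing, because only the set of pairs counts.\<close>
  then obtain b where "(a, b) \<in> set p" by auto
  then have eq: "set ((a, b) # p) = set p" by auto
  have "partial_iso A ltA colA B ltB colB ((a, b) # p)"
    using p unfolding partial_iso_def eq .
  then show ?thesis by blast
next
  case False
  have linA: "strict_linear_on A ltA" and linB: "strict_linear_on B ltB"
    using A B by (auto simp: dense_coloured_def)
  have pD: "a' \<in> A" "b' \<in> B" "colA a' = colB b'" if "(a', b') \<in> set p" for a' b'
    using p that unfolding partial_iso_def by auto
  have pp: "ltA a1 a2 \<longleftrightarrow> ltB b1 b2" "a1 = a2 \<longleftrightarrow> b1 = b2" if "(a1, b1) \<in> set p" "(a2, b2) \<in> set p" for a1 b1 a2 b2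
    using p that unfolding partial_iso_def by fast+
  define S where "S = snd ` {u\<in>set p. ltA (fst u) a}"
  define T where "T = snd ` {u\<in>set p. ltA a (fst u)}"
  have "ltB s t" if "s \<in> S" "t \<in> T" for s t
  proof -
    obtain a1 a2 where *: "(a1, s) \<in> set p" "(a2, t) \<in> set p" "ltA a1 a" "ltA a a2"
      using \<open>s \<in> S\<close> \<open>t \<in> T\<close> by (auto simp: S_def T_def)
    then have "ltA a1 a2"
      using strict_linear_on_trans[OF linA, of a1 a a2] pD a by blast
    then show ?thesis using pp * by blast
  qed
  moreover have "S \<subseteq> B" "T \<subseteq> B" "finite S" "finite T"
    using pD by (auto simp: S_def T_def)
  moreover have "colA a \<in> Cs" using A a by (auto simp: dense_coloured_def)
  ultimately obtain b where b: "b \<in> B" "colB b = colA a" "\<And>s. s \<in> S \<Longrightarrow> ltB s b" "\<And>t. t \<in> T \<Longrightarrow> ltB b t"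
    using dense_colouredD[OF B, of S T "colA a"] by blast
  have new: "(ltA a a' \<longleftrightarrow> ltB b b') \<and> (ltA a' a \<longleftrightarrow> ltB b' b) \<and> a \<noteq> a' \<and> b \<noteq> b'"
    if u: "(a', b') \<in> set p" for a' b'
  proof -
    have "a' \<noteq> a" using False u by force
    then consider "ltA a a'" "b' \<in> T" | "ltA a' a" "b' \<in> S"
      using strict_linear_on_total[OF linA a, of a'] pD(1)[OF u] u unfolding S_def T_def by force
    then show ?thesis
    proof cases
      case 1
      then have "ltB b b'" using b by blast
      with 1 show ?thesis
        using strict_linear_on_asym[OF linA a, of a'] strict_linear_on_asym[OF linB b(1), of b']
          strict_linear_on_irrefl[OF linB b(1)] pD[OF u] \<open>a' \<noteq> a\<close> by blast
    next
      case 2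
      then have "ltB b' b" using b by blast
      with 2 show ?thesis
        using strict_linear_on_asym[OF linA _ a, of a'] strict_linear_on_asym[OF linB _ b(1), of b']
          strict_linear_on_irrefl[OF linB b(1)] pD[OF u] \<open>a' \<noteq> a\<close> by blast
    qed
  qed
  have "partial_iso A ltA colA B ltB colB ((a, b) # p)"
    unfolding partial_iso_Cons
    using p a b(1,2) strict_linear_on_irrefl[OF linA a] strict_linear_on_irrefl[OF linB b(1)]
    by (auto dest: new)
  then show ?thesis by blast
qed

text \<open>This is the forth step for the inverse matching.\<close>

lemma partial_iso_back:
  assumes A: "dense_coloured A ltA colA Cs" and B: "dense_coloured B ltB colB Cs"
    and p: "partial_iso A ltA colA B ltB colB p" and b: "b \<in> B"
  shows "\<exists>a. partial_iso A ltA colA B ltB colB ((a, b) # p)"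
  using partial_iso_forth[OF B A, of "map prod.swap p" b] p b
  by (simp add: partial_iso_swap[of A ltA colA])

lemma dense_coloured_isomorphism_measurable:
  fixes A :: "'x \<Rightarrow> 'a::countable set" and B :: "'b::countable set" and colB :: "'b \<Rightarrow> 'c"
  assumes [measurable]: "\<And>a. Measurable.pred M (\<lambda>x. a \<in> A x)"
      "\<And>a a'. Measurable.pred M (\<lambda>x. lt x a a')"
    and A: "\<And>x. x \<in> space M \<Longrightarrow> dense_coloured (A x) (lt x) colA Cs"
    and B: "dense_coloured B ltB colB Cs"
  obtains F where "\<And>x. x \<in> space M \<Longrightarrow> bij_betw (F x) (A x) B"
    "\<And>x a. x \<in> space M \<Longrightarrow> a \<in> A x \<Longrightarrow> colB (F x a) = colA a"
    "\<And>x a a'. x \<in> space M \<Longrightarrow> a \<in> A x \<Longrightarrow> a' \<in> A x \<Longrightarrow> ltB (F x a) (F x a') \<longleftrightarrow> lt x a a'"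
    "\<And>a b. Measurable.pred M (\<lambda>x. a \<in> A x \<and> F x a = b)"
proof (rule back_and_forth_measurable
    [where A = A and B = B and G = "\<lambda>x. partial_iso (A x) (lt x) colA B ltB colB" and M = M])
  show "Measurable.pred M (\<lambda>x. partial_iso (A x) (lt x) colA B ltB colB p)" for p
    unfolding partial_iso_def split_def
    by (intro pred_intros_finite(3)[OF finite_set]) measurable
next
  fix F
  assume bij: "\<And>x. x \<in> space M \<Longrightarrow> bij_betw (F x) (A x) B"
    and fin: "\<And>x as. x \<in> space M \<Longrightarrow> finite as \<Longrightarrow> as \<subseteq> A x \<Longrightarrow>
      \<exists>p. partial_iso (A x) (lt x) colA B ltB colB p \<and> (\<forall>a\<in>as. (a, F x a) \<in> set p)"
    and meas: "\<And>a b. Measurable.pred M (\<lambda>x. a \<in> A x \<and> F x a = b)"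
  have "colB (F x a) = colA a \<and> (ltB (F x a) (F x a') \<longleftrightarrow> lt x a a')"
    if x: "x \<in> space M" and a: "a \<in> A x" "a' \<in> A x" for x a a'
  proof -
    \<comment> \<open>Any two points lie together in one finite matching, which decides their
      comparison.\<close>
    obtain p where p: "partial_iso (A x) (lt x) colA B ltB colB p"
      "(a, F x a) \<in> set p" "(a', F x a') \<in> set p"
      using fin[OF x, of "{a, a'}"] a by auto
    show ?thesis using partial_isoD[OF p] by simp
  qed
  with bij meas show thesis by (intro that) blast+
next
  show "set p \<subseteq> A x \<times> B" if "partial_iso (A x) (lt x) colA B ltB colB p" for x p
    using partial_isoD[OF that] by auto
next
  show "a = a' \<longleftrightarrow> b = b'" if "partial_iso (A x) (lt x) colA B ltB colB p"
    "(a, b) \<in> set p" "(a', b') \<in> set p" for x p a b a' b'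
    using partial_isoD[OF that] by simp
next
  show "\<And>x p a. x \<in> space M \<Longrightarrow> partial_iso (A x) (lt x) colA B ltB colB p \<Longrightarrow> a \<in> A x \<Longrightarrow>
    \<exists>b. partial_iso (A x) (lt x) colA B ltB colB ((a, b) # p)"
    by (rule partial_iso_forth[OF A B])
next
  show "\<And>x p b. x \<in> space M \<Longrightarrow> partial_iso (A x) (lt x) colA B ltB colB p \<Longrightarrow> b \<in> B \<Longrightarrow>
    \<exists>a. partial_iso (A x) (lt x) colA B ltB colB ((a, b) # p)"
    by (rule partial_iso_back[OF A B])
qed (simp_all add: assms(1) partial_iso_def)

text \<open>The unparametrised version, obtained with a one-point parameter space.\<close>

lemma dense_coloured_isomorphism:
  fixes A :: "'a::countable set" and B :: "'b::countable set" and colB :: "'b \<Rightarrow> 'c"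
  assumes A: "dense_coloured A lt colA Cs" and B: "dense_coloured B ltB colB Cs"
  obtains F where "bij_betw F A B" "\<And>a. a \<in> A \<Longrightarrow> colB (F a) = colA a"
    "\<And>a a'. a \<in> A \<Longrightarrow> a' \<in> A \<Longrightarrow> ltB (F a) (F a') \<longleftrightarrow> lt a a'"
proof (rule dense_coloured_isomorphism_measurable
    [where M = "count_space (UNIV :: unit set)" and A = "\<lambda>_. A" and lt = "\<lambda>_. lt" and colA = colA
      and Cs = Cs and B = B and ltB = ltB and colB = colB])
  fix F
  assume "\<And>x::unit. x \<in> space (count_space UNIV) \<Longrightarrow> bij_betw (F x) A B"
    "\<And>(x::unit) a. x \<in> space (count_space UNIV) \<Longrightarrow> a \<in> A \<Longrightarrow> colB (F x a) = colA a"
    "\<And>(x::unit) a a'. x \<in> space (count_space UNIV) \<Longrightarrow> a \<in> A \<Longrightarrow> a' \<in> A \<Longrightarrow>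
      ltB (F x a) (F x a') \<longleftrightarrow> lt a a'"
  then show thesis using that[of "F ()"] by simp
qed (use assms in simp_all)

section \<open>A colouring of the rationals with every colour dense\<close>

lemma even_odd_power_cancel:
  fixes a b a' b' :: int
  assumes "odd a" "odd b'" "a * b' * 2 ^ j = a' * b * 2 ^ k" shows "k \<le> j"
proof (rule ccontr)
  assume "\<not> k \<le> j"
  then obtain d where k: "k = Suc (j + d)" using less_imp_Suc_add[of j k] by auto
  \<comment> \<open>Cancelling \<open>2 ^ j\<close> leaves an odd number on the left and an even one
    on the right.\<close>
  have "a * b' = a' * b * 2 * 2 ^ d"
    using assms(3) unfolding k by (simp add: power_add)
  then have "even (a * b')" by simp
  with assms(1,2) show False by simp
qed

text \<open>The 2-adic valuation of the denominator.\<close>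

definition dyadic_colour :: "rat \<Rightarrow> nat" where
  "dyadic_colour q = (LEAST k. \<exists>a b :: int. odd b \<and> q = of_int a / (2 ^ k * of_int b))"

text \<open>Adding an integer keeps the denominator. This is what makes translations by integers
  colour preserving.\<close>

lemma dyadic_colour_add_int: "dyadic_colour (q + of_int m) = dyadic_colour q"
proof -
  define P :: "nat \<Rightarrow> rat \<Rightarrow> bool"
    where "P k q \<longleftrightarrow> (\<exists>a b :: int. odd b \<and> q = of_int a / (2 ^ k * of_int b))" for k q
  have *: "P k (q + of_int m)" if "P k q" for q k m
  proof -
    from that obtain a b :: int where b: "odd b" "q = of_int a / (2 ^ k * of_int b)"
      by (auto simp: P_def)
    then have "b \<noteq> 0" by auto
    then have "q + of_int m = of_int (a + m * 2 ^ k * b) / (2 ^ k * of_int b)"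
      by (simp add: b(2) field_simps)
    then show ?thesis using b(1) unfolding P_def by blast
  qed
  have "P k (q + of_int m) \<longleftrightarrow> P k q" for k
    using *[of k "q + of_int m" "- m"] *[of k q m] by auto
  then show ?thesis by (simp add: dyadic_colour_def P_def)
qed

lemma dyadic_colour_eq:
  assumes "odd a" "odd b" shows "dyadic_colour (of_int a / (2 ^ k * of_int b)) = k"
  unfolding dyadic_colour_def
proof (rule Least_equality)
  show "\<exists>a' b' :: int. odd b' \<and> (of_int a / (2 ^ k * of_int b) :: rat) = of_int a' / (2 ^ k * of_int b')"
    using assms by blast
next
  fix j assume "\<exists>a' b' :: int. odd b' \<and> (of_int a / (2 ^ k * of_int b) :: rat) = of_int a' / (2 ^ j * of_int b')"
  then obtain a' b' :: int where *: "odd b'" "(of_int a / (2 ^ k * of_int b) :: rat) = of_int a' / (2 ^ j * of_int b')"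
    by blast
  moreover have "b \<noteq> 0" "b' \<noteq> 0" using assms * by auto
  ultimately have "(of_int (a * b' * 2 ^ j) :: rat) = of_int (a' * b * 2 ^ k)"
    by (simp add: field_simps)
  then have "a * b' * 2 ^ j = a' * b * 2 ^ k" by (simp only: of_int_eq_iff)
  then show "k \<le> j" using even_odd_power_cancel assms * by blast
qed

text \<open>The fractions with denominator \<open>2 ^ k * b\<close> and odd numerator, where
  \<open>b\<close> is odd, all have colour \<open>k\<close>. For large \<open>b\<close> they are
  close together.\<close>

lemma dyadic_colour_dense:
  fixes x y :: rat assumes "x < y" shows "\<exists>z. x < z \<and> z < y \<and> dyadic_colour z = k"
proof -
  obtain m :: nat where m: "4 / (y - x) < of_nat m" using reals_Archimedean2 by blast
  \<comment> \<open>\<open>b\<close> makes the denominator large while staying odd, so it does not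
    change the power of two.\<close>
  define b :: int where "b = 2 * int m + 1"
  define N :: rat where "N = 2 ^ k * of_int b"
  have "of_nat m \<le> (of_int b :: rat)" "0 < (of_int b :: rat)" by (simp_all add: b_def)
  moreover have "(of_int b :: rat) * 1 \<le> of_int b * 2 ^ k"
    by (rule mult_left_mono) (use \<open>0 < of_int b\<close> in auto)
  ultimately have "4 / (y - x) < of_int b * 2 ^ k" "0 < (of_int b :: rat) * 2 ^ k"
    using m by (linarith, simp)
  then have N: "4 / (y - x) < N" "0 < N" by (simp_all add: N_def mult.commute)
  then have gap: "4 < N * y - N * x" using assms by (simp add: field_simps)
  define f where "f = \<lfloor>N * x\<rfloor>"
  have f: "of_int f \<le> N * x" "N * x < of_int f + 1" by (auto simp: f_def) linarith
  \<comment> \<open>One of the two integers following the floor is odd; both lie below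
    \<open>N * y\<close> because of the gap.\<close>
  define a where "a = (if odd f then f + 2 else f + 1)"
  have "odd a" by (auto simp: a_def)
  have "N * x < of_int a" "of_int a < N * y" using f gap by (auto simp: a_def)
  then have "x < of_int a / N" "of_int a / N < y" using N by (simp_all add: field_simps)
  moreover have "dyadic_colour (of_int a / N) = k"
    unfolding N_def by (rule dyadic_colour_eq) (use \<open>odd a\<close> in \<open>auto simp: b_def\<close>)
  ultimately show ?thesis by blast
qed

text \<open>Recolouring along a surjection keeps all classes dense, as each of them contains a dense
  class.\<close>

lemma dense_coloured_dyadic: 
  assumes "g ` UNIV = Cs"
  shows "dense_coloured UNIV (<) (\<lambda>q. g (dyadic_colour q)) Cs"
proof -
  have "\<exists>z. g (dyadic_colour z) = k \<and> x < z \<and> z < y" if "x < y" "k \<in> Cs" for x y k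
    using dyadic_colour_dense[OF that(1)] assms that(2) by (metis imageE)
  note mid = this
  show ?thesis
  proof (rule dense_colouredI)
    show "\<exists>z\<in>UNIV. g (dyadic_colour z) = k \<and> a < z" if "k \<in> Cs" for a k
      using mid[of a "a + 1" k] that by auto
    show "\<exists>z\<in>UNIV. g (dyadic_colour z) = k \<and> z < a" if "k \<in> Cs" for a k
      using mid[of "a - 1" a k] that by auto
  qed (use assms mid strict_linear_on_less in auto)
qed

section \<open>The structure \<open>S(n)\<close> as a coloured order\<close>

text \<open>The argument in units of one n-th of the circle. Its integer part is the number of the
  arc, its fractional part the place reached when that arc is rotated onto the first one.\<close>

definition turn :: "nat \<Rightarrow> complex \<Rightarrow> real" where
  "turn n x = Arg2pi x * real n / (2 * pi)"

definition sector :: "nat \<Rightarrow> complex \<Rightarrow> int" where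
  "sector n x = \<lfloor>turn n x\<rfloor>"

definition pos :: "nat \<Rightarrow> complex \<Rightarrow> real" where
  "pos n x = frac (turn n x)"

lemma turn_eq: "turn n x = of_int (sector n x) + pos n x"
  by (simp add: sector_def pos_def frac_def)

lemma pos_bounds: "0 \<le> pos n x" "pos n x < 1"
  by (simp_all add: pos_def frac_lt_1)

lemma turn_bounds: "0 < n \<Longrightarrow> 0 \<le> turn n x \<and> turn n x < n"
  using Arg2pi[of x] by (simp add: turn_def field_simps)

text \<open>The argument of a quotient is the difference of the arguments up to a full turn, and a
  full turn has length \<open>n\<close> in these units.\<close>

lemma turn_div:
  assumes "x \<noteq> 0" "y \<noteq> 0"
  obtains e :: int where "turn n (x / y) = turn n x - turn n y + real_of_int e * real n"
proof (cases "Arg2pi y \<le> Arg2pi x")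
  case True
  then have "turn n (x / y) = turn n x - turn n y + real_of_int 0 * real n"
    using Arg2pi_divide[OF assms(2,1)] by (simp add: turn_def left_diff_distrib diff_divide_distrib)
  then show ?thesis by (rule that)
next
  case False
  then have *: "Arg2pi (y / x) = Arg2pi y - Arg2pi x"
    using Arg2pi_divide[OF assms(1,2)] by simp
  with False have "Arg2pi (y / x) \<noteq> 0" by simp
  then have "Arg2pi (inverse (y / x)) = 2 * pi - Arg2pi (y / x)"
    using Arg2pi_eq_0_pi[of "y / x"] unfolding Arg2pi_inverse by auto
  then have "Arg2pi (x / y) = Arg2pi x - Arg2pi y + 2 * pi"
    using * by (simp add: inverse_eq_divide)
  then have "turn n (x / y) = turn n x - turn n y + real_of_int 1 * real n"
    by (simp add: turn_def left_diff_distrib distrib_right diff_divide_distrib add_divide_distrib)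
  then show ?thesis by (rule that)
qed

context
  fixes D :: "complex set" and n :: nat
  assumes D: "generic_dense_set D" and n: "2 \<le> n"
begin

lemma D_nonzero: "x \<in> D \<Longrightarrow> x \<noteq> 0"
  using D by (auto simp: generic_dense_set_def)

lemma Arg2pi_irrational:
  assumes "x \<in> D" "y \<in> D" "x \<noteq> y" "q \<in> \<rat>"
  shows "Arg2pi x \<noteq> q * pi" "Arg2pi (x / y) \<noteq> q * pi"
  using D assms by (auto simp: generic_dense_set_def)

lemma turn_div_not_int:
  assumes "x \<in> D" "y \<in> D" "x \<noteq> y" shows "turn n (x / y) \<noteq> of_int z"
proof
  assume "turn n (x / y) = of_int z"
  then have "Arg2pi (x / y) = (2 * of_int z / of_nat n) * pi"
    using n by (simp add: turn_def field_simps)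
  moreover have "(2 * of_int z / of_nat n :: real) \<in> \<rat>" by simp
  ultimately show False using Arg2pi_irrational(2) assms by blast
qed

text \<open>Points in the same place of their arcs differ by an integral number of arcs, so the
  argument of their quotient would be a rational multiple of \<pi>.\<close>

lemma pos_inj: assumes "x \<in> D" "y \<in> D" "pos n x = pos n y" shows "x = y"
proof (rule ccontr)
  assume "x \<noteq> y"
  obtain e :: int where "turn n (x / y) = turn n x - turn n y + real_of_int e * real n"
    using turn_div D_nonzero assms by blast
  then have "turn n (x / y) = of_int (sector n x - sector n y + e * n)"
    using assms(3) by (simp add: turn_eq)
  then show False using turn_div_not_int assms \<open>x \<noteq> y\<close> by blast
qed

lemma sector_bounds: "sector n x \<in> {0..<int n}"
  using turn_bounds[of n x] n by (simp add: sector_def floor_less_iff)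

text \<open>The k-th relation says that \<open>turn n (x / y)\<close> has integer part
  \<open>k\<close>. Subtracting turns subtracts the sectors, with a borrow of 1 when
  \<open>x\<close> lies earlier in its arc than \<open>y\<close>, and full turns vanish modulo
  \<open>n\<close>.\<close>

lemma S_arrow_iff:
  assumes x: "x \<in> D" and y: "y \<in> D" and k: "k < n"
  shows "S_arrow n k x y \<longleftrightarrow>
    x \<noteq> y \<and> int k = (sector n x - sector n y - (if pos n y < pos n x then 0 else 1)) mod int n"
proof (cases "x = y")
  case True
  have "Arg2pi 1 = 0" by (simp add: Arg2pi_eq_0)
  moreover have "\<not> 2 * pi * real k / real n < 0"
    unfolding not_less by (intro divide_nonneg_nonneg mult_nonneg_nonneg) auto
  ultimately show ?thesis using True D_nonzero[OF y] by (simp add: S_arrow_def)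
next
  case False
  obtain e :: int where e: "turn n (x / y) = turn n x - turn n y + real_of_int e * real n"
    using turn_div D_nonzero x y by blast
  have ne: "pos n x \<noteq> pos n y" using pos_inj x y False by blast
  define d where "d = sector n x - sector n y - (if pos n y < pos n x then 0 else 1)"
  have fl: "\<lfloor>turn n (x / y)\<rfloor> = d + e * n"
  proof (rule floor_unique)
    show "of_int (d + e * n) \<le> turn n (x / y)" "turn n (x / y) < of_int (d + e * n) + 1"
      using ne pos_bounds[of n x] pos_bounds[of n y]
      unfolding e turn_eq[of n x] turn_eq[of n y] by (auto simp: d_def)
  qed
  have "0 \<le> d + e * n" "d + e * n < n"
    using turn_bounds[of n "x / y"] n unfolding fl[symmetric] by (simp_all add: floor_less_iff)
  then have "(d + e * n) mod int n = d + e * n" by (rule mod_pos_pos_trivial)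
  moreover have "(d + e * n) mod int n = d mod int n" by (rule mod_mult_self1)
  ultimately have mod: "\<lfloor>turn n (x / y)\<rfloor> = d mod int n" by (simp add: fl)
  have "S_arrow n k x y \<longleftrightarrow> real k < turn n (x / y) \<and> turn n (x / y) < real k + 1"
    using n by (auto simp: S_arrow_def turn_def field_simps)
  also have "\<dots> \<longleftrightarrow> \<lfloor>turn n (x / y)\<rfloor> = int k"
    \<comment> \<open>The left end point of the interval is excluded by genericity, so the open
      interval and the half-open one of the floor agree.\<close>
    using turn_div_not_int[OF x y False, of "int k"] by (simp add: floor_eq_iff) linarith
  finally show ?thesis using False unfolding mod d_def by auto
qed

text \<open>Pick a point \<open>w\<close> of the circle strictly inside the prescribed part of the
  arc. \<open>turn n\<close> is continuous there, so nearby points of \<open>D\<close> lie in the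
  same part.\<close>

lemma D_dense:
  assumes s: "0 \<le> s" "s < u" "u \<le> 1" and k: "k \<in> {0..<int n}"
  shows "\<exists>x\<in>D. sector n x = k \<and> s < pos n x \<and> pos n x < u"
proof -
  obtain m where m: "s < m" "m < u" using dense s(2) by blast
  define r where "r = of_int k + m"
  have "0 \<le> real_of_int k" "real_of_int k + 1 \<le> real n" using k by auto
  then have r: "0 < r" "r < n" unfolding r_def using s m by simp_all
  define w where "w = exp (\<i> * of_real (2 * pi * r / n))"
  have arg: "Arg2pi w = 2 * pi * r / n"
    by (rule Arg2pi_unique[of 1]) (use r n in \<open>auto simp: w_def field_simps\<close>)
  \<comment> \<open>\<open>Arg2pi\<close> jumps at the nonnegative real axis, which the strict
    bounds on \<open>r\<close> avoid.\<close>
  have "w \<notin> \<real>\<^sub>\<ge>\<^sub>0"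
  proof
    assume "w \<in> \<real>\<^sub>\<ge>\<^sub>0"
    then have "Arg2pi w = 0" by (simp add: Arg2pi_eq_0 complex_nonneg_Reals_iff complex_is_Real_iff)
    with arg r n show False by simp
  qed
  then have "isCont (turn n) w"
    unfolding turn_def using continuous_at_Arg2pi[of w] by (auto intro!: continuous_intros)
  moreover have "0 < min (m - s) (u - m)" using m by simp
  ultimately obtain d where d: "d > 0" "\<And>x. dist x w < d \<Longrightarrow> dist (turn n x) (turn n w) < min (m - s) (u - m)"
    unfolding continuous_at_eps_delta by meson
  have "w \<in> sphere 0 1" by (simp add: w_def)
  then have "w \<in> closure D" using D by (auto simp: generic_dense_set_def)
  then obtain x where x: "x \<in> D" "dist x w < d"
    using d(1) by (auto simp: closure_approachable)
  have "turn n w = r" using n by (simp add: turn_def arg)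
  then have t: "of_int k + s < turn n x" "turn n x < of_int k + u"
    using d(2)[OF x(2)] by (auto simp: dist_real_def r_def field_simps abs_less_iff)
  then have "sector n x = k"
    unfolding sector_def using s by (intro floor_unique) auto
  with t x(1) show ?thesis by (auto simp: turn_eq)
qed

lemma dense_coloured_D:
  "dense_coloured D (\<lambda>x y. pos n x < pos n y) (sector n) {0..<int n}"
proof (rule dense_colouredI)
  show "strict_linear_on D (\<lambda>x y. pos n x < pos n y)"
    unfolding strict_linear_on_def using pos_inj
    by (auto simp: irreflp_on_def transp_on_def totalp_on_def) (meson linorder_neqE)
  show "\<exists>z\<in>D. sector n z = k \<and> pos n x < pos n z" if "k \<in> {0..<int n}" for x k
    using D_dense[of "pos n x" 1 k] pos_bounds[of n x] that by auto
  have "\<exists>z\<in>D. sector n z = k \<and> pos n z < pos n x" if x: "x \<in> D" and k: "k \<in> {0..<int n}" for x k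
  proof -
    \<comment> \<open>There is no least element: a point at the start of an arc would have an
      argument that is a rational multiple of \<pi>.\<close>
    have "pos n x \<noteq> 0"
    proof
      assume "pos n x = 0"
      then have "Arg2pi x = (2 * of_int (sector n x) / of_nat n) * pi"
        using n turn_eq[of n x] by (simp add: turn_def field_simps)
      moreover have "(2 * of_int (sector n x) / of_nat n :: real) \<in> \<rat>" by simp
      \<comment> \<open>Genericity speaks of pairs of distinct points, so a second point is
        supplied.\<close>
      moreover obtain y where "y \<in> D" "y \<noteq> x"
        using D_dense[of "pos n x" 1 0] pos_bounds[of n x] n by auto
      ultimately show False using Arg2pi_irrational(1)[OF x, of y] by metis
    qed
    then show ?thesis
      using D_dense[of 0 "pos n x" k] pos_bounds[of n x] k by auto
  qed
  then show "\<exists>z\<in>D. sector n z = k \<and> pos n z < pos n x" if "x \<in> D" "k \<in> {0..<int n}" for x k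
    using that by blast
  show "\<exists>z\<in>D. sector n z = k \<and> pos n x < pos n z \<and> pos n z < pos n y"
    if "pos n x < pos n y" "k \<in> {0..<int n}" for x y k
    using D_dense[of "pos n x" "pos n y" k] pos_bounds[of n x] pos_bounds[of n y] that by auto
  show "D \<noteq> {}" using D_dense[of 0 1 0] n by auto
qed (use sector_bounds in auto)

text \<open>If \<open>D\<close> were finite, density would give a point of \<open>D\<close> above
  all of \<open>D\<close>, including itself.\<close>

lemma infinite_D: "infinite D"
proof
  assume "finite D"
  obtain z where "z \<in> D" "\<And>s. s \<in> D \<Longrightarrow> pos n s < pos n z"
    by (rule dense_colouredD[OF dense_coloured_D \<open>finite D\<close>, of "{}" 0]) (use n in auto)
  then show False by blast
qed

lemma D_isomorphism_measurable:
  fixes A :: "'x \<Rightarrow> 'a::countable set"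
  assumes "\<And>a. Measurable.pred M (\<lambda>x. a \<in> A x)" "\<And>a a'. Measurable.pred M (\<lambda>x. lt x a a')"
    and "\<And>x. x \<in> space M \<Longrightarrow> dense_coloured (A x) (lt x) col {0..<int n}"
  obtains H where "\<And>x. x \<in> space M \<Longrightarrow> bij_betw (H x) (A x) D"
    "\<And>x a. x \<in> space M \<Longrightarrow> a \<in> A x \<Longrightarrow> sector n (H x a) = col a"
    "\<And>x a a'. x \<in> space M \<Longrightarrow> a \<in> A x \<Longrightarrow> a' \<in> A x \<Longrightarrow> pos n (H x a) < pos n (H x a') \<longleftrightarrow> lt x a a'"
    "\<And>a d. Measurable.pred M (\<lambda>x. a \<in> A x \<and> H x a = d)"
proof -
  \<comment> \<open>The complex numbers are not a countable type, so the back-and-forth runs on the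
    indices of an enumeration of \<open>D\<close>.\<close>
  define e where "e = from_nat_into D"
  have e: "bij_betw e UNIV D"
    unfolding e_def using D infinite_D by (intro bij_betw_from_nat_into) (auto simp: generic_dense_set_def)
  have De: "D = range e" and inj: "inj e" using e by (auto simp: bij_betw_def)
  have dense: "dense_coloured UNIV (\<lambda>i j. pos n (e i) < pos n (e j)) (\<lambda>i. sector n (e i)) {0..<int n}"
  proof (rule dense_colouredI)
    fix a b k assume k: "k \<in> {0..<int n}"
    note ext = dense_colouredD[OF dense_coloured_D, of "e ` S" "e ` T" k for S T]
    show "\<exists>z\<in>UNIV. sector n (e z) = k \<and> pos n (e a) < pos n (e z)"
      by (rule ext[of "{a}" "{}"]) (use k De in auto)
    show "\<exists>z\<in>UNIV. sector n (e z) = k \<and> pos n (e z) < pos n (e a)"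
      by (rule ext[of "{}" "{a}"]) (use k De in auto)
    show "\<exists>z\<in>UNIV. sector n (e z) = k \<and> pos n (e a) < pos n (e z) \<and> pos n (e z) < pos n (e b)"
      if "pos n (e a) < pos n (e b)"
      by (rule ext[of "{a}" "{b}"]) (use that k De in auto)
  next
    have "pos n (e i) \<noteq> pos n (e j)" if "i \<noteq> j" for i j
      using that pos_inj[of "e i" "e j"] De inj by (auto dest: injD)
    then show "strict_linear_on UNIV (\<lambda>i j. pos n (e i) < pos n (e j))"
      unfolding strict_linear_on_def
      by (auto simp: irreflp_on_def transp_on_def totalp_on_def) (meson linorder_neqE)
  qed (use sector_bounds in auto)
  show thesis
  proof (rule dense_coloured_isomorphism_measurable
      [where M = M and A = A and lt = lt and colA = col, OF assms(1,2) _ dense])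
    fix F
    assume F: "\<And>x. x \<in> space M \<Longrightarrow> bij_betw (F x) (A x) (UNIV :: nat set)"
      "\<And>x a. x \<in> space M \<Longrightarrow> a \<in> A x \<Longrightarrow> sector n (e (F x a)) = col a"
      "\<And>x a a'. x \<in> space M \<Longrightarrow> a \<in> A x \<Longrightarrow> a' \<in> A x \<Longrightarrow>
        pos n (e (F x a)) < pos n (e (F x a')) \<longleftrightarrow> lt x a a'"
      "\<And>a i. Measurable.pred M (\<lambda>x. a \<in> A x \<and> F x a = i)"
    show thesis
    proof (rule that[of "\<lambda>x a. e (F x a)"])
      show "bij_betw (\<lambda>a. e (F x a)) (A x) D" if "x \<in> space M" for x
        using bij_betw_trans[OF F(1)[OF that] e] by (simp add: comp_def)
      show "Measurable.pred M (\<lambda>x. a \<in> A x \<and> e (F x a) = d)" for a d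
      proof (cases "d \<in> D")
        case True
        then obtain i where "d = e i" using De by auto
        then have "(a \<in> A x \<and> e (F x a) = d) \<longleftrightarrow> (a \<in> A x \<and> F x a = i)" for x
          using inj by (auto dest: injD)
        then show ?thesis using F(4)[of a i] by simp
      next
        case False
        then have "(\<lambda>x. a \<in> A x \<and> e (F x a) = d) = (\<lambda>_. False)" using De by auto
        then show ?thesis by simp
      qed
    qed (use F in auto)
  qed (rule assms(3))
qed

end

section \<open>Blowing up a linear order\<close>

lemma conjugacy_Aut_S_iff:
  assumes \<phi>: "\<phi> \<in> carrier (Aut_S D n)" and \<psi>: "\<psi> \<in> carrier (Aut_S D n)"
  shows "(\<phi>, \<psi>) \<in> conjugacy (Aut_S D n) \<longleftrightarrow>
    (\<exists>\<delta>\<in>carrier (Aut_S D n). \<forall>d\<in>D. \<psi> (\<delta> d) = \<delta> (\<phi> d))"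
proof -
  interpret group "Aut_S D n" by (rule group_Aut_S)
  have Bij: "f \<in> Bij D" if "f \<in> carrier (Aut_S D n)" for f
    using that by (simp add: carrier_Aut_S)
  have mult: "f \<otimes>\<^bsub>Aut_S D n\<^esub> g = compose D f g"
    if "f \<in> carrier (Aut_S D n)" "g \<in> carrier (Aut_S D n)" for f g
    using Bij[OF that(1)] Bij[OF that(2)] by (simp add: Aut_S_def BijGroup_def)
  have "\<psi> = \<delta> \<otimes>\<^bsub>Aut_S D n\<^esub> \<phi> \<otimes>\<^bsub>Aut_S D n\<^esub> inv\<^bsub>Aut_S D n\<^esub> \<delta> \<longleftrightarrow>
      (\<forall>d\<in>D. \<psi> (\<delta> d) = \<delta> (\<phi> d))" if \<delta>: "\<delta> \<in> carrier (Aut_S D n)" for \<delta>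
  proof -
    have "\<psi> = \<delta> \<otimes>\<^bsub>Aut_S D n\<^esub> \<phi> \<otimes>\<^bsub>Aut_S D n\<^esub> inv\<^bsub>Aut_S D n\<^esub> \<delta> \<longleftrightarrow>
        \<psi> \<otimes>\<^bsub>Aut_S D n\<^esub> \<delta> = \<delta> \<otimes>\<^bsub>Aut_S D n\<^esub> \<phi>"
      using \<phi> \<psi> \<delta> by (metis inv_solve_right m_closed)
    also have "\<dots> \<longleftrightarrow> compose D \<psi> \<delta> = compose D \<delta> \<phi>"
      using \<phi> \<psi> \<delta> by (simp add: mult)
    also have "\<dots> \<longleftrightarrow> (\<forall>d\<in>D. \<psi> (\<delta> d) = \<delta> (\<phi> d))"
      \<comment> \<open>Outside \<open>D\<close> both composites take the same default
        value.\<close>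
      by (auto simp: compose_def restrict_def fun_eq_iff)
    finally show ?thesis .
  qed
  then show ?thesis using \<phi> \<psi> unfolding conjugacy_def by auto
qed

text \<open>The formula of \<open>S_arrow_iff\<close> for an arbitrary coloured order: the number of
  the relation that leads from \<open>a\<close> to \<open>b\<close> when they are distinct.\<close>

definition arrow_index :: "nat \<Rightarrow> ('a \<Rightarrow> 'a \<Rightarrow> bool) \<Rightarrow> ('a \<Rightarrow> int) \<Rightarrow> 'a \<Rightarrow> 'a \<Rightarrow> int" where
  "arrow_index n lt col a b = (col a - col b - (if lt b a then 0 else 1)) mod int n"

lemma arrow_index_range: "0 < n \<Longrightarrow> arrow_index n lt col a b \<in> {0..<int n}"
  by (simp add: arrow_index_def)

text \<open>With equal colours the index is 0 or -1 modulo \<open>n\<close>, and these differ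
  because \<open>n\<close> is at least 2. Thus the index determines the order inside a colour
  class.\<close>

lemma arrow_index_same_colour:
  "2 \<le> n \<Longrightarrow> col a = col b \<Longrightarrow> arrow_index n lt col a b = 0 \<longleftrightarrow> lt b a"
  by (auto simp: arrow_index_def zmod_minus1)

abbreviation D_less :: "nat \<Rightarrow> complex \<Rightarrow> complex \<Rightarrow> bool" where
  "D_less n x y \<equiv> pos n x < pos n y"

text \<open>Between two distinct points exactly one of the \<open>n\<close> relations holds, and the
  index is its number.\<close>

lemma Bij_in_Aut_S_iff:
  assumes D: "generic_dense_set D" and n: "2 \<le> n" and g: "g \<in> Bij D"
  shows "g \<in> carrier (Aut_S D n) \<longleftrightarrow>
    (\<forall>x\<in>D. \<forall>y\<in>D. x \<noteq> y \<longrightarrow>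
      arrow_index n (D_less n) (sector n) (g x) (g y) = arrow_index n (D_less n) (sector n) x y)"
proof -
  have g_D: "g x \<in> D" if "x \<in> D" for x
    using g that by (auto simp: Bij_def bij_betw_def)
  have g_eq: "g x = g y \<longleftrightarrow> x = y" if "x \<in> D" "y \<in> D" for x y
    using g that by (auto simp: Bij_def bij_betw_def inj_on_def)
  have S: "S_arrow n k x y \<longleftrightarrow> x \<noteq> y \<and> int k = arrow_index n (D_less n) (sector n) x y"
    if "k < n" "x \<in> D" "y \<in> D" for k x y
    unfolding arrow_index_def by (rule S_arrow_iff[OF D n that(2,3,1)])
  have "(\<forall>k<n. S_arrow n k x y \<longleftrightarrow> S_arrow n k (g x) (g y)) \<longleftrightarrow>
     (x \<noteq> y \<longrightarrow> arrow_index n (D_less n) (sector n) (g x) (g y) = arrow_index n (D_less n) (sector n) x y)"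
    (is "?L \<longleftrightarrow> ?R") if xy: "x \<in> D" "y \<in> D" for x y
  proof
    assume L: ?L
    show ?R
    proof
      assume ne: "x \<noteq> y"
      define k where "k = nat (arrow_index n (D_less n) (sector n) x y)"
      have k: "int k = arrow_index n (D_less n) (sector n) x y" "k < n"
        using arrow_index_range[of n "D_less n" "sector n" x y] n by (auto simp: k_def)
      then have "S_arrow n k (g x) (g y)" using L S[of k x y] xy ne by simp
      then show "arrow_index n (D_less n) (sector n) (g x) (g y) = arrow_index n (D_less n) (sector n) x y"
        using S[of k "g x" "g y"] g_D xy k by simp
    qed
  next
    assume ?R
    then show ?L using S g_D g_eq xy by auto
  qed
  then show ?thesis
    using g by (auto simp: carrier_Aut_S)
qed

lemma order_automorphism_in_Aut_S:
  assumes D: "generic_dense_set D" and n: "2 \<le> n" and g: "bij_betw g D D"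
    and sec: "\<And>x. x \<in> D \<Longrightarrow> sector n (g x) = sector n x"
    and less: "\<And>x y. x \<in> D \<Longrightarrow> y \<in> D \<Longrightarrow> pos n (g x) < pos n (g y) \<longleftrightarrow> pos n x < pos n y"
  shows "restrict g D \<in> carrier (Aut_S D n)"
proof -
  have "restrict g D \<in> Bij D" using g by (simp add: Bij_def bij_betw_restrict_eq)
  then show ?thesis
    by (simp add: Bij_in_Aut_S_iff[OF D n] arrow_index_def sec less)
qed

text \<open>
  Each element of the order \<open>K\<close> is blown up to a copy of the rationals, and a marker copy,
  \<open>None\<close>, is put below all of them.  The shift moves the marker downwards and all other copies
  upwards, so that its orbitals are the copies and the marker is the only one moved downwards.
\<close>

definition blowup :: "'l set \<Rightarrow> ('l option \<times> rat) set" where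
  "blowup K = insert None (Some ` K) \<times> UNIV"

fun option_less :: "('l \<Rightarrow> 'l \<Rightarrow> bool) \<Rightarrow> 'l option \<Rightarrow> 'l option \<Rightarrow> bool" where
  "option_less lt None None = False"
| "option_less lt None (Some l) = True"
| "option_less lt (Some l) None = False"
| "option_less lt (Some l) (Some l') = lt l l'"

definition blowup_less :: "('l \<Rightarrow> 'l \<Rightarrow> bool) \<Rightarrow> 'l option \<times> rat \<Rightarrow> 'l option \<times> rat \<Rightarrow> bool" where
  "blowup_less lt a b \<longleftrightarrow> option_less lt (fst a) (fst b) \<or> fst a = fst b \<and> snd a < snd b"

definition blowup_colour :: "nat \<Rightarrow> 'l option \<times> rat \<Rightarrow> int" where
  "blowup_colour n a = int (dyadic_colour (snd a) mod n)"

definition shift :: "'l option \<times> rat \<Rightarrow> 'l option \<times> rat" where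
  "shift a = (fst a, if fst a = None then snd a - 1 else snd a + 1)"

lemma mem_blowup [simp]: "(None, q) \<in> blowup K" "(Some l, q) \<in> blowup K \<longleftrightarrow> l \<in> K"
  by (auto simp: blowup_def)

lemma fst_shift [simp]: "fst (shift a) = fst a"
  by (simp add: shift_def)

lemma shift_in_blowup [simp]: "shift a \<in> blowup K \<longleftrightarrow> a \<in> blowup K"
  by (simp add: shift_def blowup_def mem_Times_iff)

lemma shift_neq [simp]: "shift a \<noteq> a" 
  by (cases a) (auto simp: shift_def)

lemma bij_betw_shift: "bij_betw shift (blowup K) (blowup K)"
  by (rule bij_betw_byWitness
      [where f' = "\<lambda>a. (fst a, if fst a = None then snd a + 1 else snd a - 1)"])
    (auto simp: shift_def blowup_def)

lemma blowup_colour_shift [simp]: "blowup_colour n (shift a) = blowup_colour n a"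
  using dyadic_colour_add_int[of "snd a" 1] dyadic_colour_add_int[of "snd a" "- 1"]
  by (simp add: blowup_colour_def shift_def)

lemma blowup_less_shift [simp]: "blowup_less lt (shift a) (shift b) \<longleftrightarrow> blowup_less lt a b"
  by (auto simp: blowup_less_def shift_def)

lemma blowup_less_simps [simp]:
  "blowup_less lt (None, q) (Some l, r)"
  "\<not> blowup_less lt (Some l, r) (None, q)"
  "blowup_less lt (None, q) (None, r) \<longleftrightarrow> q < r"
  "blowup_less lt (Some l, q) (Some l', r) \<longleftrightarrow> lt l l' \<or> l = l' \<and> q < r"
  by (auto simp: blowup_less_def)

lemma strict_linear_on_blowup:
  assumes lin: "strict_linear_on K lt"
  shows "strict_linear_on (blowup K) (blowup_less lt)"
  unfolding strict_linear_on_def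
proof (intro conjI)
  note irrefl = strict_linear_on_irrefl[OF lin] and trans = strict_linear_on_trans[OF lin]
    and total = strict_linear_on_total[OF lin]
  show "irreflp_on (blowup K) (blowup_less lt)"
  proof (rule irreflp_onI)
    fix a assume "a \<in> blowup K"
    then show "\<not> blowup_less lt a a"
      by (cases a; cases "fst a") (auto simp: irrefl)
  qed
  show "transp_on (blowup K) (blowup_less lt)"
  proof (rule transp_onI)
    fix a b c assume "a \<in> blowup K" "b \<in> blowup K" "c \<in> blowup K" "blowup_less lt a b" "blowup_less lt b c"
    then show "blowup_less lt a c"
      by (cases a; cases b; cases c; cases "fst a"; cases "fst b"; cases "fst c") (auto dest: trans)
  qed
  show "totalp_on (blowup K) (blowup_less lt)"
  proof (rule totalp_onI)
    fix a b assume "a \<in> blowup K" "b \<in> blowup K" "a \<noteq> b"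
    then show "blowup_less lt a b \<or> blowup_less lt b a"
      using total[of "the (fst a)" "the (fst b)"]
      by (cases a; cases b; cases "fst a"; cases "fst b") (auto simp: neq_iff)
  qed
qed

lemma dense_coloured_blowup:
  assumes lin: "strict_linear_on K lt" and n: "0 < n"
  shows "dense_coloured (blowup K) (blowup_less lt) (blowup_colour n) {0..<int n}"
proof -
  have ex: "\<exists>q. x < q \<and> q < y \<and> int (dyadic_colour q mod n) = k" if "x < y" "k \<in> {0..<int n}" for x y k
    using dyadic_colour_dense[OF that(1), of "nat k"] that(2) by (auto simp: nat_less_iff)
  have above: "\<exists>z\<in>blowup K. blowup_colour n z = k \<and> fst z = fst a \<and> snd a < snd z" if "a \<in> blowup K" "k \<in> {0..<int n}" for a k
    using ex[of "snd a" "snd a + 1" k] that by (force simp: blowup_def blowup_colour_def)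
  have below: "\<exists>z\<in>blowup K. blowup_colour n z = k \<and> fst z = fst a \<and> snd z < snd a" if "a \<in> blowup K" "k \<in> {0..<int n}" for a k
    using ex[of "snd a - 1" "snd a" k] that by (force simp: blowup_def blowup_colour_def)
  show ?thesis
  proof (rule dense_colouredI)
    fix a b k assume a: "a \<in> blowup K" and b: "b \<in> blowup K" and ab: "blowup_less lt a b" and k: "k \<in> {0..<int n}"
    show "\<exists>z\<in>blowup K. blowup_colour n z = k \<and> blowup_less lt a z \<and> blowup_less lt z b"
    proof (cases "fst a = fst b")
      case True
      then have "snd a < snd b"
        using ab strict_linear_on_irrefl[OF lin] a b
        by (cases "fst a") (auto simp: blowup_less_def blowup_def)
      from ex[OF this k] obtain q where "snd a < q" "q < snd b" "int (dyadic_colour q mod n) = k"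
        by blast
      then show ?thesis using a b True
        by (intro bexI[of _ "(fst a, q)"]) (auto simp: blowup_less_def blowup_colour_def blowup_def)
    next
      case False
      \<comment> \<open>A point higher up in the copy of \<open>a\<close> is still below every point
        of the later copy containing \<open>b\<close>.\<close>
      obtain z where "z \<in> blowup K" "blowup_colour n z = k" "fst z = fst a" "snd a < snd z"
        using above[OF a k] by blast
      then show ?thesis using False ab by (auto simp: blowup_less_def)
    qed
  next
    show "\<exists>z\<in>blowup K. blowup_colour n z = k \<and> blowup_less lt a z" if "a \<in> blowup K" "k \<in> {0..<int n}" for a k
      using above[OF that] by (auto simp: blowup_less_def)
    show "\<exists>z\<in>blowup K. blowup_colour n z = k \<and> blowup_less lt z a" if "a \<in> blowup K" "k \<in> {0..<int n}" for a k
      using below[OF that] by (auto simp: blowup_less_def)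
    show "blowup K \<noteq> {}" by (auto simp: blowup_def)
  qed (use n strict_linear_on_blowup[OF lin] in \<open>auto simp: blowup_colour_def\<close>)
qed

text \<open>\<open>G\<close> arises from an automorphism of S(n), so it need not preserve order or
  colours. It preserves the marker, however, and seen from the marker it preserves equality of
  colours and hence the order inside each colour class. The integers of a copy form one shift orbit
  of a single colour; following them recovers the copies and their order.\<close>

lemma order_iso_of_blowup_iso:
  fixes K :: "'l set" and K' :: "'m set"
  assumes lin: "strict_linear_on K lt" and lin': "strict_linear_on K' lt'" and n: "2 \<le> n"
    and G: "bij_betw G (blowup K) (blowup K')"
    and shift: "\<And>a. a \<in> blowup K \<Longrightarrow> G (shift a) = shift (G a)"
    and index: "\<And>a b. a \<in> blowup K \<Longrightarrow> b \<in> blowup K \<Longrightarrow> a \<noteq> b \<Longrightarrow>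
      arrow_index n (blowup_less lt') (blowup_colour n) (G a) (G b) =
      arrow_index n (blowup_less lt) (blowup_colour n) a b"
  shows "\<exists>\<theta>. bij_betw \<theta> K K' \<and> (\<forall>l\<in>K. \<forall>l'\<in>K. lt l l' \<longleftrightarrow> lt' (\<theta> l) (\<theta> l'))"
proof -
  have G_in: "G a \<in> blowup K'" if "a \<in> blowup K" for a
    using G that by (auto simp: bij_betw_def)
  have shift_less: "blowup_less lt a (shift a) \<longleftrightarrow> fst a \<noteq> None" if "a \<in> blowup K" "strict_linear_on K lt"
    for a K and lt :: "'k \<Rightarrow> 'k \<Rightarrow> bool"
    using that strict_linear_on_irrefl[OF that(2)] by (cases a; cases "fst a") (auto simp: shift_def)
  \<comment> \<open>\<open>a\<close> and \<open>shift a\<close> have the same colour, so the index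
    tells whether the shift moves \<open>a\<close> up or down.\<close>
  have fst_None: "fst (G a) = None \<longleftrightarrow> fst a = None" if a: "a \<in> blowup K" for a
    using arrow_index_same_colour[OF n, of "blowup_colour n" "shift a" a "blowup_less lt"]
      arrow_index_same_colour[OF n, of "blowup_colour n" "shift (G a)" "G a" "blowup_less lt'"]
      shift_less[OF a lin] shift_less[OF G_in[OF a] lin'] index[of "shift a" a] shift[OF a] a
    by auto
  obtain r0 where G0: "G (None, 0) = (None, r0)"
    using fst_None[of "(None, 0)"] by (cases "G (None, 0)") auto
  have bounds: "blowup_colour n a \<in> {0..<int n}" for a :: "'k option \<times> rat"
    using n by (simp add: blowup_colour_def)
  \<comment> \<open>All points outside the marker lie above the chosen marker point, and so do their
    images. No borrow occurs, and the index is the difference of the colours.\<close>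
  have colour_cong: "(blowup_colour n (G a) - blowup_colour n (None :: 'm option, r0)) mod int n =
      (blowup_colour n a - blowup_colour n (None :: 'l option, 0)) mod int n"
    if a: "a \<in> blowup K" "fst a \<noteq> None" for a
  proof -
    have "blowup_less lt (None, 0) a" "blowup_less lt' (None, r0) (G a)"
      using a fst_None[OF a(1)] by (auto simp: blowup_less_def)
    moreover have "a \<noteq> (None, 0)" using a(2) by auto
    ultimately show ?thesis
      using index[OF a(1), of "(None, 0)"] by (simp add: arrow_index_def G0)
  qed
  have diff_mod: "x = y" if "(x - z) mod int n = (y - z) mod int n" "x \<in> {0..<int n}" "y \<in> {0..<int n}" for x y z
  proof -
    have "x mod int n = y mod int n" using that(1) by (metis diff_add_cancel mod_add_left_eq)
    then show ?thesis using that(2,3) by simp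
  qed
  have same_colour: "blowup_colour n (G a) = blowup_colour n (G b) \<longleftrightarrow> blowup_colour n a = blowup_colour n b"
    if "a \<in> blowup K" "fst a \<noteq> None" "b \<in> blowup K" "fst b \<noteq> None" for a b
    using colour_cong[OF that(1,2)] colour_cong[OF that(3,4)] diff_mod[OF _ bounds bounds] by metis
  have mono: "blowup_less lt' (G a) (G b)"
    if ab: "a \<in> blowup K" "fst a \<noteq> None" "b \<in> blowup K" "fst b \<noteq> None"
      "blowup_colour n a = blowup_colour n b" "blowup_less lt a b" for a b
  proof -
    have "a \<noteq> b"
      using ab strict_linear_on_irrefl[OF strict_linear_on_blowup[OF lin]] by blast
    then have "arrow_index n (blowup_less lt') (blowup_colour n) (G b) (G a) = 0"
      using index[OF ab(3,1)] ab(5,6) arrow_index_same_colour[OF n, of "blowup_colour n" b a]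
      by simp
    then show ?thesis
      using arrow_index_same_colour[OF n, of "blowup_colour n" "G b" "G a"] same_colour[OF ab(1-4)] ab(5) by simp
  qed
  have iter: "G (Some l, q + of_nat m) = (fst (G (Some l, q)), snd (G (Some l, q)) + of_nat m)"
    if l: "l \<in> K" for l q m
  proof (induction m)
    case (Suc m)
    have "fst (G (Some l, q)) \<noteq> None" using fst_None[of "(Some l, q)"] l by simp
    then show ?case
      using shift[of "(Some l, q + of_nat m)"] l Suc by (auto simp: shift_def ac_simps)
  qed simp
  \<comment> \<open>The copy that receives the point 0 of the copy \<open>l\<close>; by
    \<open>iter\<close> it receives all integers of that copy.\<close>
  define \<theta> where "\<theta> l = the (fst (G (Some l, 0)))" for l
  define r where "r l = snd (G (Some l, 0))" for l
  have G\<theta>: "G (Some l, 0) = (Some (\<theta> l), r l)" and \<theta>_in: "\<theta> l \<in> K'" if "l \<in> K" for l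
  proof -
    have "fst (G (Some l, 0)) \<noteq> None" using fst_None[of "(Some l, 0)"] that by simp
    then show *: "G (Some l, 0) = (Some (\<theta> l), r l)" by (auto simp: \<theta>_def r_def prod_eq_iff)
    show "\<theta> l \<in> K'" using G_in[of "(Some l, 0)"] that by (simp add: *)
  qed
  have up: "G (Some l, of_nat m) = (Some (\<theta> l), r l + of_nat m)" if "l \<in> K" for l m
    using iter[OF that, of 0 m] G\<theta>[OF that] by simp
  have down: "fst (G (Some l, - of_nat m)) = Some (\<theta> l)" if "l \<in> K" for l m
    using iter[OF that, of "- of_nat m" m] G\<theta>[OF that] by (simp add: prod_eq_iff)
  have col_nat: "dyadic_colour (of_nat m) = dyadic_colour 0"
    "dyadic_colour (- of_nat m) = dyadic_colour 0" for m
    using dyadic_colour_add_int[of 0 "int m"] dyadic_colour_add_int[of 0 "- int m"] by simp_all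
  \<comment> \<open>A point with the colour of the integers is squeezed between two integers whose
    images lie in the same copy.\<close>
  have block: "fst (G (Some l, q)) = Some (\<theta> l)"
    if l: "l \<in> K" and q: "blowup_colour n (Some l, q) = blowup_colour n (Some l, 0)" for l q
  proof -
    obtain m :: nat where "\<bar>q\<bar> < of_nat m" using reals_Archimedean2 by blast
    then have m: "- of_nat m < q" "q < of_nat m" by auto
    have "blowup_less lt' (G (Some l, - of_nat m)) (G (Some l, q))"
      by (rule mono) (use l q m in \<open>auto simp: blowup_colour_def col_nat\<close>)
    moreover have "blowup_less lt' (G (Some l, q)) (G (Some l, of_nat m))"
      by (rule mono) (use l q m in \<open>auto simp: blowup_colour_def col_nat\<close>)
    moreover obtain l' where l': "fst (G (Some l, q)) = Some l'"
      using fst_None[of "(Some l, q)"] l by auto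
    moreover have "l' \<in> K'" using G_in[of "(Some l, q)"] l l' by (auto simp: blowup_def)
    ultimately show ?thesis
      using up[OF l, of m] down[OF l, of m] strict_linear_on_asym[OF lin' \<theta>_in[OF l], of l']
      by (auto simp: blowup_less_def)
  qed
  have \<theta>_mono: "lt' (\<theta> l) (\<theta> l')" if l: "l \<in> K" "l' \<in> K" "lt l l'" for l l'
  proof (rule ccontr)
    assume contra: "\<not> lt' (\<theta> l) (\<theta> l')"
    \<comment> \<open>All integers of the copy \<open>l\<close> must be sent below the image of 0 in
      the copy \<open>l'\<close>. If the two images shared a copy, a large integer would overtake
      that point.\<close>
    obtain m :: nat where "r l' - r l < of_nat m" using reals_Archimedean2 by blast
    moreover have "blowup_less lt' (G (Some l, of_nat m)) (G (Some l', 0))"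
      by (rule mono) (use l in \<open>auto simp: blowup_colour_def col_nat\<close>)
    ultimately show False
      using contra by (simp add: up[OF l(1)] G\<theta>[OF l(2)])
  qed
  have \<theta>_iff: "lt l l' \<longleftrightarrow> lt' (\<theta> l) (\<theta> l')" if "l \<in> K" "l' \<in> K" for l l'
    using \<theta>_mono[OF that] \<theta>_mono[OF that(2,1)] strict_linear_on_total[OF lin that]
      strict_linear_on_asym[OF lin' \<theta>_in[OF that(1)] \<theta>_in[OF that(2)]]
      strict_linear_on_irrefl[OF lin' \<theta>_in[OF that(1)]] by blast
  have "bij_betw \<theta> K K'"
  proof (rule bij_betw_imageI)
    show "inj_on \<theta> K"
    proof (rule inj_onI)
      fix l l' assume "l \<in> K" "l' \<in> K" "\<theta> l = \<theta> l'"
      then show "l = l'"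
        using strict_linear_on_total[OF lin, of l l'] \<theta>_mono[of l l'] \<theta>_mono[of l' l]
          strict_linear_on_irrefl[OF lin' \<theta>_in[of l]] by metis
    qed
    show "\<theta> ` K = K'"
    proof
      show "K' \<subseteq> \<theta> ` K"
      proof
        fix l' assume l': "l' \<in> K'"
        have pre: "\<exists>l q. l \<in> K \<and> G (Some l, q) = (Some l', s)" for s
        proof -
          have "(Some l', s) \<in> G ` blowup K" using G l' by (auto simp: bij_betw_def)
          then obtain a where a: "a \<in> blowup K" "G a = (Some l', s)" by auto
          then obtain l where "fst a = Some l" using fst_None[OF a(1)] by auto
          with a show ?thesis by (cases a) auto
        qed
        \<comment> \<open>Some image of a point 0 is needed as a colour sample: a preimage of a
          point with second coordinate \<open>r l1\<close> has the colour of the integers, so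
          \<open>block\<close> applies to it.\<close>
        obtain l1 q1 where l1: "l1 \<in> K" using pre[of 0] by blast
        obtain l q where l: "l \<in> K" "G (Some l, q) = (Some l', r l1)" using pre by blast
        have "blowup_colour n (G (Some l, q)) = blowup_colour n (G (Some l1, 0))"
          using l G\<theta>[OF l1] by (simp add: blowup_colour_def)
        then have "blowup_colour n (Some l, q) = blowup_colour n (Some l1, 0)"
          using same_colour[of "(Some l, q)" "(Some l1, 0)"] l l1 by simp
        then have "\<theta> l = l'" using block[OF l(1), of q] l(2) by (simp add: blowup_colour_def)
        with l(1) show "l' \<in> \<theta> ` K" by blast
      qed
    qed (use \<theta>_in in auto)
  qed
  with \<theta>_iff show ?thesis by blast
qed

section \<open>Reducing isomorphism of linear orders to conjugacy\<close>

definition order_isomorphic ::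
    "'a set \<Rightarrow> ('a \<Rightarrow> 'a \<Rightarrow> bool) \<Rightarrow> 'b set \<Rightarrow> ('b \<Rightarrow> 'b \<Rightarrow> bool) \<Rightarrow> bool" where
  "order_isomorphic K lt K' lt' \<longleftrightarrow>
     (\<exists>\<theta>. bij_betw \<theta> K K' \<and> (\<forall>l\<in>K. \<forall>l'\<in>K. lt l l' \<longleftrightarrow> lt' (\<theta> l) (\<theta> l')))"

lemma blowup_iso_of_order_iso:
  assumes \<theta>: "bij_betw \<theta> K K'" and lt: "\<And>l l'. l \<in> K \<Longrightarrow> l' \<in> K \<Longrightarrow> lt l l' \<longleftrightarrow> lt' (\<theta> l) (\<theta> l')"
  defines "T \<equiv> map_prod (map_option \<theta>) id"
  shows "bij_betw T (blowup K) (blowup K')"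
    and "shift (T a) = T (shift a)"
    and "blowup_colour n (T a) = blowup_colour n a"
    and "a \<in> blowup K \<Longrightarrow> b \<in> blowup K \<Longrightarrow> blowup_less lt' (T a) (T b) \<longleftrightarrow> blowup_less lt a b"
proof -
  have inj: "\<theta> l = \<theta> l' \<longleftrightarrow> l = l'" if "l \<in> K" "l' \<in> K" for l l'
    using \<theta> that by (auto simp: bij_betw_def inj_on_def)
  show "bij_betw T (blowup K) (blowup K')"
  proof (rule bij_betw_imageI)
    show "inj_on T (blowup K)"
      by (rule inj_onI) (auto simp: T_def blowup_def inj)
    have "T ` blowup K = (map_option \<theta> ` insert None (Some ` K)) \<times> UNIV"
      unfolding T_def blowup_def map_prod_image by simp
    also have "map_option \<theta> ` insert None (Some ` K) = insert None (Some ` K')"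
      using \<theta> by (force simp: bij_betw_def image_image)
    finally show "T ` blowup K = blowup K'" by (simp add: blowup_def)
  qed
  show "shift (T a) = T (shift a)"
    by (simp add: T_def shift_def map_prod_def split_def)
  show "blowup_colour n (T a) = blowup_colour n a"
    by (simp add: T_def blowup_colour_def)
  show "blowup_less lt' (T a) (T b) \<longleftrightarrow> blowup_less lt a b" if "a \<in> blowup K" "b \<in> blowup K"
    using that lt inj by (cases a; cases b; cases "fst a"; cases "fst b") (auto simp: T_def)
qed

text \<open>\<open>f x\<close> is the shift carried over to \<open>D\<close> by \<open>H x\<close>.
  A conjugating automorphism pulls back to a map of blowups that commutes with the shifts, and an
  isomorphism of the orders, acting on the copies only, pushes forward to a conjugating
  automorphism.\<close>

lemma orders_reduce_to_conjugacy:
  fixes K :: "'x \<Rightarrow> 'l::countable set"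
  assumes D: "generic_dense_set D" and n: "2 \<le> n"
    and K_meas: "\<And>l. Measurable.pred M (\<lambda>x. l \<in> K x)"
    and lt_meas: "\<And>l l'. Measurable.pred M (\<lambda>x. lt x l l')"
    and lin: "\<And>x. x \<in> space M \<Longrightarrow> strict_linear_on (K x) (lt x)"
  shows "\<exists>f\<in>measurable M (Aut_S_space D n). \<forall>x\<in>space M. \<forall>x'\<in>space M.
    (f x, f x') \<in> conjugacy (Aut_S D n) \<longleftrightarrow> order_isomorphic (K x) (lt x) (K x') (lt x')"
proof (rule D_isomorphism_measurable
    [where M = M and A = "\<lambda>x. blowup (K x)" and lt = "\<lambda>x. blowup_less (lt x)" and col = "blowup_colour n", OF D n])
  show "Measurable.pred M (\<lambda>x. a \<in> blowup (K x))" for a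
    using K_meas by (cases a; cases "fst a") auto
  show "Measurable.pred M (\<lambda>x. blowup_less (lt x) a b)" for a b
    using lt_meas by (cases a; cases b; cases "fst a"; cases "fst b") auto
  show "dense_coloured (blowup (K x)) (blowup_less (lt x)) (blowup_colour n) {0..<int n}"
    if "x \<in> space M" for x
    using dense_coloured_blowup[OF lin[OF that]] n by simp
next
  fix H
  assume H: "\<And>x. x \<in> space M \<Longrightarrow> bij_betw (H x) (blowup (K x)) D"
    and H_col: "\<And>x a. x \<in> space M \<Longrightarrow> a \<in> blowup (K x) \<Longrightarrow> sector n (H x a) = blowup_colour n a"
    and H_less: "\<And>x a a'. x \<in> space M \<Longrightarrow> a \<in> blowup (K x) \<Longrightarrow> a' \<in> blowup (K x) \<Longrightarrow>
      pos n (H x a) < pos n (H x a') \<longleftrightarrow> blowup_less (lt x) a a'"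
    and [measurable]: "\<And>a d. Measurable.pred M (\<lambda>x. a \<in> blowup (K x) \<and> H x a = d)"
  define H' where "H' x = inv_into (blowup (K x)) (H x)" for x
  define f where "f x = restrict (H x \<circ> shift \<circ> H' x) D" for x
  have H': "bij_betw (H' x) D (blowup (K x))" if "x \<in> space M" for x
    unfolding H'_def using bij_betw_inv_into[OF H[OF that]] .
  have H'_in: "H' x d \<in> blowup (K x)" if "x \<in> space M" "d \<in> D" for x d
    using H'[OF that(1)] that(2) by (auto simp: bij_betw_def)
  have H_in: "H x a \<in> D" if "x \<in> space M" "a \<in> blowup (K x)" for x a
    using H[OF that(1)] that(2) by (auto simp: bij_betw_def)
  have HH' [simp]: "H x (H' x d) = d" if "x \<in> space M" "d \<in> D" for x d
    unfolding H'_def using bij_betw_inv_into_right[OF H[OF that(1)] that(2)] .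
  have H'H [simp]: "H' x (H x a) = a" if "x \<in> space M" "a \<in> blowup (K x)" for x a
    unfolding H'_def using bij_betw_inv_into_left[OF H[OF that(1)] that(2)] .
  have sec: "sector n d = blowup_colour n (H' x d)" if "x \<in> space M" "d \<in> D" for x d
    using H_col[OF that(1) H'_in[OF that]] that by simp
  have less: "pos n d < pos n d' \<longleftrightarrow> blowup_less (lt x) (H' x d) (H' x d')"
    if "x \<in> space M" "d \<in> D" "d' \<in> D" for x d d'
    using H_less[OF that(1) H'_in[OF that(1,2)] H'_in[OF that(1,3)]] that by simp
  have f_carrier: "f x \<in> carrier (Aut_S D n)" if x: "x \<in> space M" for x
    unfolding f_def
  proof (rule order_automorphism_in_Aut_S[OF D n])
    show "bij_betw (H x \<circ> shift \<circ> H' x) D D"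
      using bij_betw_trans[OF bij_betw_trans[OF H'[OF x] bij_betw_shift] H[OF x]] by (simp add: comp_assoc)
    show "sector n ((H x \<circ> shift \<circ> H' x) d) = sector n d" if "d \<in> D" for d
      using that x by (simp add: H_col H'_in sec)
    show "pos n ((H x \<circ> shift \<circ> H' x) d) < pos n ((H x \<circ> shift \<circ> H' x) d') \<longleftrightarrow> pos n d < pos n d'"
      if "d \<in> D" "d' \<in> D" for d d'
      using that x by (simp add: H_less H'_in less)
  qed
  have "f \<in> measurable M (Aut_S_space D n)"
    unfolding Aut_S_space_def
  proof (rule measurable_restrict_space2)
    show "f \<in> space M \<rightarrow> carrier (Aut_S D n)" using f_carrier by blast
    show "f \<in> measurable M (PiM D (\<lambda>_. count_space D))"
      unfolding f_def restrict_def[of _ D]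
    proof (rule measurable_PiM_single')
      fix d assume d: "d \<in> D"
      have "(\<lambda>x. (H x \<circ> shift \<circ> H' x) d) \<in> measurable M (count_space D)"
      proof (rule measurable_count_space_eq_countable[THEN iffD2])
        show "countable D" using D by (simp add: generic_dense_set_def)
        have "(\<lambda>x. (H x \<circ> shift \<circ> H' x) d) -` {e} \<inter> space M \<in> sets M" if "e \<in> D" for e
        proof -
          \<comment> \<open>Replacing the inverse of \<open>H x\<close> by an existential over
            countably many points expresses the event through the measurable graph of
            \<open>H x\<close>.\<close>
          have "(H x \<circ> shift \<circ> H' x) d = e \<longleftrightarrow>
              (\<exists>a. (a \<in> blowup (K x) \<and> H x a = d) \<and> (shift a \<in> blowup (K x) \<and> H x (shift a) = e))"
            (is "?L \<longleftrightarrow> ?R") if x: "x \<in> space M" for x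
          proof
            assume ?L
            then show ?R using x d H'_in[OF x d] by (intro exI[of _ "H' x d"]) simp
          next
            assume ?R
            then show ?L using x by auto
          qed
          then have "(\<lambda>x. (H x \<circ> shift \<circ> H' x) d) -` {e} \<inter> space M =
            {x\<in>space M. \<exists>a. (a \<in> blowup (K x) \<and> H x a = d) \<and> (shift a \<in> blowup (K x) \<and> H x (shift a) = e)}"
            by blast
          also have "\<dots> \<in> sets M" by measurable
          finally show ?thesis .
        qed
        then show "(\<lambda>x. (H x \<circ> shift \<circ> H' x) d) \<in> space M \<rightarrow> D \<and>
            (\<forall>e\<in>D. (\<lambda>x. (H x \<circ> shift \<circ> H' x) d) -` {e} \<inter> space M \<in> sets M)"
          using d H_in H'_in by auto
      qed
      then show "(\<lambda>x. if d \<in> D then (H x \<circ> shift \<circ> H' x) d else undefined) \<in> measurable M (count_space D)"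
        using d by simp
    qed (use H_in H'_in in \<open>auto simp: PiE_def extensional_def\<close>)
  qed
  moreover have "(f x, f x') \<in> conjugacy (Aut_S D n) \<longleftrightarrow> order_isomorphic (K x) (lt x) (K x') (lt x')"
    if x: "x \<in> space M" and x': "x' \<in> space M" for x x'
  proof -
    have f_in: "f x d \<in> D" if "d \<in> D" for d
      using that x H_in H'_in by (simp add: f_def)
    have "(\<exists>\<delta>\<in>carrier (Aut_S D n). \<forall>d\<in>D. f x' (\<delta> d) = \<delta> (f x d)) \<longleftrightarrow>
        order_isomorphic (K x) (lt x) (K x') (lt x')" (is "?L \<longleftrightarrow> ?R")
    proof
      assume ?L
      then obtain \<delta> where \<delta>: "\<delta> \<in> carrier (Aut_S D n)" and comm: "\<And>d. d \<in> D \<Longrightarrow> f x' (\<delta> d) = \<delta> (f x d)"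
        by blast
      have Bij: "\<delta> \<in> Bij D" using \<delta> by (simp add: carrier_Aut_S)
      then have bij: "bij_betw \<delta> D D" by (simp add: Bij_def)
      have \<delta>_in: "\<delta> d \<in> D" if "d \<in> D" for d using bij that by (auto simp: bij_betw_def)
      have idx: "arrow_index n (D_less n) (sector n) (\<delta> d) (\<delta> e) = arrow_index n (D_less n) (sector n) d e"
        if "d \<in> D" "e \<in> D" "d \<noteq> e" for d e
        using \<delta> that Bij_in_Aut_S_iff[OF D n Bij] by blast
      define G where "G = H' x' \<circ> \<delta> \<circ> H x"
      show ?R
        unfolding order_isomorphic_def
      proof (rule order_iso_of_blowup_iso[OF lin[OF x] lin[OF x'] n])
        show "bij_betw G (blowup (K x)) (blowup (K x'))"
          unfolding G_def using bij_betw_trans[OF bij_betw_trans[OF H[OF x] bij] H'[OF x']]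
          by (simp add: comp_assoc)
        show "G (shift a) = shift (G a)" if a: "a \<in> blowup (K x)" for a
        proof -
          have "\<delta> (H x (shift a)) = H x' (shift (H' x' (\<delta> (H x a))))"
            using comm[OF H_in[OF x a]] x x' a by (simp add: f_def H_in \<delta>_in)
          then show ?thesis using x x' a by (simp add: G_def H_in H'_in \<delta>_in)
        qed
        show "arrow_index n (blowup_less (lt x')) (blowup_colour n) (G a) (G b) =
            arrow_index n (blowup_less (lt x)) (blowup_colour n) a b"
          if ab: "a \<in> blowup (K x)" "b \<in> blowup (K x)" "a \<noteq> b" for a b
        proof -
          have "arrow_index n (blowup_less (lt x')) (blowup_colour n) (G a) (G b) =
              arrow_index n (D_less n) (sector n) (\<delta> (H x a)) (\<delta> (H x b))"
            using ab x x'
            by (simp add: arrow_index_def G_def sec[of x'] less[of x'] H_in \<delta>_in)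
          also have "\<dots> = arrow_index n (D_less n) (sector n) (H x a) (H x b)"
            by (rule idx) (use ab x H_in H'H in \<open>metis+\<close>)
          also have "\<dots> = arrow_index n (blowup_less (lt x)) (blowup_colour n) a b"
            using ab x by (simp add: arrow_index_def H_col H_less)
          finally show ?thesis .
        qed
      qed
    next
      assume ?R
      then obtain \<theta> where \<theta>: "bij_betw \<theta> (K x) (K x')"
        and lt: "\<And>l l'. l \<in> K x \<Longrightarrow> l' \<in> K x \<Longrightarrow> lt x l l' \<longleftrightarrow> lt x' (\<theta> l) (\<theta> l')"
        unfolding order_isomorphic_def by blast
      define T where "T = map_prod (map_option \<theta>) (id :: rat \<Rightarrow> rat)"
      note T = blowup_iso_of_order_iso[where lt = "lt x" and lt' = "lt x'", OF \<theta> lt, folded T_def]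
      have T_in: "T a \<in> blowup (K x')" if "a \<in> blowup (K x)" for a
        using T(1) that by (auto simp: bij_betw_def)
      define \<delta> where "\<delta> = restrict (H x' \<circ> T \<circ> H' x) D"
      have "\<delta> \<in> carrier (Aut_S D n)"
        unfolding \<delta>_def
      proof (rule order_automorphism_in_Aut_S[OF D n])
        show "bij_betw (H x' \<circ> T \<circ> H' x) D D"
          using bij_betw_trans[OF bij_betw_trans[OF H'[OF x] T(1)] H[OF x']] by (simp add: comp_assoc)
        show "sector n ((H x' \<circ> T \<circ> H' x) d) = sector n d" if "d \<in> D" for d
          using that x x' by (simp add: H_col H'_in T_in T(3) sec[of x])
        show "pos n ((H x' \<circ> T \<circ> H' x) d) < pos n ((H x' \<circ> T \<circ> H' x) d') \<longleftrightarrow> pos n d < pos n d'"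
          if "d \<in> D" "d' \<in> D" for d d'
          using that x x' by (simp add: H_less H'_in T_in T(4) less[of x])
      qed
      moreover have "f x' (\<delta> d) = \<delta> (f x d)" if "d \<in> D" for d
        using that x x' f_in by (simp add: f_def \<delta>_def H_in H'_in T_in T(2))
      ultimately show ?L by blast
    qed
    then show ?thesis by (simp add: conjugacy_Aut_S_iff f_carrier x x')
  qed
  ultimately show ?thesis by blast
qed

lemma atom_measurable [measurable]:
  "a \<in> atoms L ar \<Longrightarrow> Measurable.pred (restrict_space (structures L ar) C) (\<lambda>A. A a)"
  unfolding structures_def
  by (intro measurable_restrict_space1 measurable_component_singleton)

lemma linear_orders_reduce_to_conjugacy:
  assumes D: "generic_dense_set D" and n: "2 \<le> n"
  shows "borel_reducible linear_order_space linear_order_isomorphism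
           (Aut_S_space D n) (conjugacy (Aut_S D n))"
proof -
  define lt where "lt A i j \<longleftrightarrow> A ((), [i, j]) \<and> i \<noteq> j" for A :: "unit \<times> nat list \<Rightarrow> bool" and i j
  have atom: "((), [i, j]) \<in> atoms UNIV (\<lambda>_. 2)" for i j :: nat by (simp add: atoms_def)
  have space: "space linear_order_space = linear_orders"
    by (auto simp: linear_order_space_def space_restrict_space linear_orders_def)
  have "\<exists>f\<in>measurable linear_order_space (Aut_S_space D n).
    \<forall>A\<in>space linear_order_space. \<forall>B\<in>space linear_order_space.
      (f A, f B) \<in> conjugacy (Aut_S D n) \<longleftrightarrow> order_isomorphic UNIV (lt A) UNIV (lt B)"
  proof (rule orders_reduce_to_conjugacy[OF D n])
    show "Measurable.pred linear_order_space (\<lambda>A. lt A i j)" for i j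
      unfolding lt_def linear_order_space_def using atom_measurable[OF atom] by measurable
    show "strict_linear_on UNIV (lt A)" if "A \<in> space linear_order_space" for A
    proof -
      have "linear_order_on UNIV {(x, y). A ((), [x, y])}"
        using that by (simp add: space linear_orders_def)
      then have "trans {(x, y). A ((), [x, y])}" "antisym {(x, y). A ((), [x, y])}"
        "total {(x, y). A ((), [x, y])}"
        by (auto simp: order_on_defs)
      then show ?thesis
        by (auto simp: strict_linear_on_def lt_def irreflp_on_def totalp_on_def total_on_def
            intro!: transp_onI dest: antisymD transD)
    qed
  qed simp
  moreover have "(A, B) \<in> linear_order_isomorphism \<longleftrightarrow> order_isomorphic UNIV (lt A) UNIV (lt B)"
    if "A \<in> linear_orders" "B \<in> linear_orders" for A B
  proof -
    \<comment> \<open>Diagonal atoms hold in both structures, so the strict parts determine the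
      reflexive orders.\<close>
    have reflexive: "A ((), [i, i])" "B ((), [i, i])" for i
      using that by (auto simp: linear_orders_def order_on_defs refl_on_def)
    have "(\<forall>(r, xs)\<in>atoms UNIV (\<lambda>_. 2). A (r, xs) \<longleftrightarrow> B (r, map f xs)) \<longleftrightarrow>
        (\<forall>i j. lt A i j \<longleftrightarrow> lt B (f i) (f j))" (is "?L \<longleftrightarrow> ?R") if f: "bij f" for f
    proof
      assume L: ?L
      have "A ((), [i, j]) \<longleftrightarrow> B ((), [f i, f j])" for i j
        using bspec[OF L atom[of i j]] by simp
      then show ?R using f by (auto simp: lt_def bij_def dest: injD)
    next
      assume R: ?R
      have "A ((), [i, j]) \<longleftrightarrow> B ((), [f i, f j])" for i j
        using R[rule_format, of i j] reflexive f by (cases "i = j") (auto simp: lt_def bij_def dest: injD)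
      then show ?L by (auto simp: atoms_def numeral_2_eq_2 length_Suc_conv)
    qed
    then have "(\<exists>f. bij f \<and> (\<forall>(r, xs)\<in>atoms UNIV (\<lambda>_. 2). A (r, xs) \<longleftrightarrow> B (r, map f xs))) \<longleftrightarrow>
        (\<exists>f. bij f \<and> (\<forall>i j. lt A i j \<longleftrightarrow> lt B (f i) (f j)))"
      by (intro ex_cong1 conj_cong refl)
    then show ?thesis
      using that by (simp add: linear_order_isomorphism_def isomorphism_def order_isomorphic_def)
  qed
  ultimately show ?thesis
    unfolding borel_reducible_def space by blast
qed

section \<open>Recovering a labelled tree from a linear order\<close>

definition lexless :: "'a::linorder \<times> nat \<Rightarrow> 'a \<times> nat \<Rightarrow> bool" where
  "lexless p q \<longleftrightarrow> fst p < fst q \<or> fst p = fst q \<and> snd p < snd q"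

lemma strict_linear_on_lexless: "strict_linear_on K lexless"
  unfolding strict_linear_on_def irreflp_on_def transp_on_def totalp_on_def lexless_def
  by (auto simp: prod_eq_iff)

lemma infinite_between:
  fixes s t :: "'a::linorder"
  assumes dense: "\<And>s t :: 'a. s < t \<Longrightarrow> \<exists>r. s < r \<and> r < t" and "s < t"
  shows "infinite {r. s < r \<and> r < t}"
proof
  assume fin: "finite {r. s < r \<and> r < t}"
  moreover have "{r. s < r \<and> r < t} \<noteq> {}" using dense[OF \<open>s < t\<close>] by blast
  ultimately have Max: "Max {r. s < r \<and> r < t} \<in> {r. s < r \<and> r < t}" by (rule Max_in)
  then obtain r where r: "Max {r. s < r \<and> r < t} < r" "r < t" using dense by blast
  with Max have "r \<in> {r. s < r \<and> r < t}" by auto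
  then show False using Max_ge[OF fin] r(1) by fastforce
qed

text \<open>The block of \<open>s\<close> has \<open>N s + 1\<close> points, hence is never empty,
  even for the label 0.\<close>

definition block_sum :: "('a \<Rightarrow> nat) \<Rightarrow> ('a \<times> nat) set" where
  "block_sum N = {(s, i). i \<le> N s}"

text \<open>Density puts infinitely many nonempty blocks between two different ones, whereas a
  single block is finite. So the order alone defines the blocks.\<close>

lemma finite_between_iff:
  fixes N :: "'a::linorder \<Rightarrow> nat"
  assumes dense: "\<And>s t :: 'a. s < t \<Longrightarrow> \<exists>r. s < r \<and> r < t"
    and p: "p \<in> block_sum N" and q: "q \<in> block_sum N" and pq: "lexless p q"
  shows "finite {r \<in> block_sum N. lexless p r \<and> lexless r q} \<longleftrightarrow> fst p = fst q"
proof
  assume fin: "finite {r \<in> block_sum N. lexless p r \<and> lexless r q}"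
  show "fst p = fst q"
  proof (rule ccontr)
    assume "fst p \<noteq> fst q"
    then have "fst p < fst q" using pq by (auto simp: lexless_def)
    have "(\<lambda>r. (r, 0)) ` {r. fst p < r \<and> r < fst q} \<subseteq> {r \<in> block_sum N. lexless p r \<and> lexless r q}"
      by (auto simp: block_sum_def lexless_def)
    then have "finite {r. fst p < r \<and> r < fst q}"
      using fin by (metis (no_types, lifting) finite_imageD finite_subset inj_onI prod.inject)
    then show False using infinite_between[OF dense \<open>fst p < fst q\<close>] by blast
  qed
next
  assume "fst p = fst q"
  then have "{r \<in> block_sum N. lexless p r \<and> lexless r q} \<subseteq> {fst p} \<times> {..N (fst p)}"
    by (auto simp: block_sum_def lexless_def)
  then show "finite {r \<in> block_sum N. lexless p r \<and> lexless r q}"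
    by (rule finite_subset) simp
qed

text \<open>Finiteness of intervals is invariant, so blocks go onto blocks. The induced map of
  blocks preserves their order, and their cardinalities give the labels.\<close>

lemma block_sum_iso:
  fixes N N' :: "'a::linorder \<Rightarrow> nat"
  assumes dense: "\<And>s t :: 'a. s < t \<Longrightarrow> \<exists>r. s < r \<and> r < t"
    and iso: "order_isomorphic (block_sum N) lexless (block_sum N') lexless"
  obtains \<Theta> where "bij \<Theta>" "\<And>s t. \<Theta> s < \<Theta> t \<longleftrightarrow> s < t" "\<And>s. N' (\<Theta> s) = N s"
proof -
  obtain \<theta> where bij: "bij_betw \<theta> (block_sum N) (block_sum N')"
    and less: "\<And>p q. p \<in> block_sum N \<Longrightarrow> q \<in> block_sum N \<Longrightarrow> lexless p q \<longleftrightarrow> lexless (\<theta> p) (\<theta> q)"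
    using iso unfolding order_isomorphic_def by blast
  have \<theta>_in: "\<theta> p \<in> block_sum N'" if "p \<in> block_sum N" for p
    using bij that by (auto simp: bij_betw_def)
  have \<theta>_onto: "\<exists>p\<in>block_sum N. \<theta> p = p'" if "p' \<in> block_sum N'" for p'
    using bij_betw_imp_surj_on[OF bij] that by (metis imageE)
  have inj: "inj_on \<theta> (block_sum N)" using bij by (simp add: bij_betw_def)
  have block_less: "fst (\<theta> p) = fst (\<theta> q) \<longleftrightarrow> fst p = fst q"
    if pq: "p \<in> block_sum N" "q \<in> block_sum N" "lexless p q" for p q
  proof -
    have eq: "\<theta> ` {r \<in> block_sum N. lexless p r \<and> lexless r q} =
        {r \<in> block_sum N'. lexless (\<theta> p) r \<and> lexless r (\<theta> q)}" (is "_ ` ?X = ?Y")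
    proof
      show "\<theta> ` ?X \<subseteq> ?Y"
        using less[OF pq(1)] less[OF _ pq(2)] \<theta>_in by blast
      show "?Y \<subseteq> \<theta> ` ?X"
      proof
        fix r' assume r': "r' \<in> ?Y"
        then obtain r where r: "r \<in> block_sum N" "\<theta> r = r'" using \<theta>_onto by blast
        then have "r \<in> ?X" using r' less[OF pq(1) r(1)] less[OF r(1) pq(2)] by simp
        with r(2) show "r' \<in> \<theta> ` ?X" by blast
      qed
    qed
    have "inj_on \<theta> {r \<in> block_sum N. lexless p r \<and> lexless r q}"
      by (rule inj_on_subset[OF inj]) auto
    then have "finite {r \<in> block_sum N'. lexless (\<theta> p) r \<and> lexless r (\<theta> q)} \<longleftrightarrow>
        finite {r \<in> block_sum N. lexless p r \<and> lexless r q}"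
      unfolding eq[symmetric] by (rule finite_image_iff)
    then show ?thesis
      using finite_between_iff[OF dense pq]
        finite_between_iff[OF dense \<theta>_in[OF pq(1)] \<theta>_in[OF pq(2)]] less[OF pq(1,2)] pq(3) by simp
  qed
  have block: "fst (\<theta> p) = fst (\<theta> q) \<longleftrightarrow> fst p = fst q" if "p \<in> block_sum N" "q \<in> block_sum N" for p q
    using strict_linear_on_total[OF strict_linear_on_lexless that] block_less[OF that] block_less[OF that(2,1)]
    by auto
  define \<Theta> where "\<Theta> s = fst (\<theta> (s, 0))" for s
  have zero: "(s, 0) \<in> block_sum M" for s and M :: "'a \<Rightarrow> nat" by (simp add: block_sum_def)
  have fst\<theta>: "fst (\<theta> p) = \<Theta> (fst p)" if "p \<in> block_sum N" for p
    unfolding \<Theta>_def using block[OF that zero[of "fst p"]] by simp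
  have \<Theta>_inj: "\<Theta> s = \<Theta> t \<longleftrightarrow> s = t" for s t
    unfolding \<Theta>_def using block[OF zero zero] by simp
  have \<Theta>_mono: "\<Theta> s < \<Theta> t" if "s < t" for s t
  proof -
    have "lexless (\<theta> (s, 0)) (\<theta> (t, 0))"
      using less[OF zero[of s] zero[of t]] that by (simp add: lexless_def)
    then show ?thesis using \<Theta>_inj[of s t] that by (auto simp: lexless_def \<Theta>_def)
  qed
  have \<Theta>_less: "\<Theta> s < \<Theta> t \<longleftrightarrow> s < t" for s t
    using \<Theta>_mono[of s t] \<Theta>_mono[of t s] by (metis less_asym linorder_neqE)
  have "\<exists>s. t = \<Theta> s" for t
    using \<theta>_onto[OF zero[of t]] fst\<theta> by (metis fst_conv)
  then have "bij \<Theta>" using \<Theta>_inj by (auto simp: bij_def inj_def surj_def)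
  have "N' (\<Theta> s) = N s" for s
  proof -
    have eq: "\<theta> ` ({s} \<times> {..N s}) = {\<Theta> s} \<times> {..N' (\<Theta> s)}"
    proof
      show "\<theta> ` ({s} \<times> {..N s}) \<subseteq> {\<Theta> s} \<times> {..N' (\<Theta> s)}"
      proof
        fix p' assume "p' \<in> \<theta> ` ({s} \<times> {..N s})"
        then obtain i where i: "(s, i) \<in> block_sum N" "p' = \<theta> (s, i)" by (auto simp: block_sum_def)
        then show "p' \<in> {\<Theta> s} \<times> {..N' (\<Theta> s)}"
          using fst\<theta>[OF i(1)] \<theta>_in[OF i(1)] by (cases p') (auto simp: block_sum_def)
      qed
      show "{\<Theta> s} \<times> {..N' (\<Theta> s)} \<subseteq> \<theta> ` ({s} \<times> {..N s})"
      proof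
        fix p' assume p': "p' \<in> {\<Theta> s} \<times> {..N' (\<Theta> s)}"
        then obtain p where p: "p \<in> block_sum N" "\<theta> p = p'"
          using \<theta>_onto[of p'] by (auto simp: block_sum_def)
        then have "fst p = s" using fst\<theta>[OF p(1)] p' \<Theta>_inj by auto
        then show "p' \<in> \<theta> ` ({s} \<times> {..N s})"
          using p by (intro image_eqI[of _ _ p]) (auto simp: block_sum_def)
      qed
    qed
    have "inj_on \<theta> ({s} \<times> {..N s})"
      by (rule inj_on_subset[OF inj]) (auto simp: block_sum_def)
    then have "card ({\<Theta> s} \<times> {..N' (\<Theta> s)}) = card ({s} \<times> {..N s})"
      unfolding eq[symmetric] by (rule card_image)
    then show ?thesis by (simp add: card_cartesian_product)
  qed
  with \<open>bij \<Theta>\<close> \<Theta>_less show thesis by (rule that)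
qed

section \<open>Finite sequences under the lexicographic order\<close>

lemma less_append: "v \<noteq> [] \<Longrightarrow> s < s @ v" for s v :: "'a::linorder list"
  by (induction s) (auto simp: neq_Nil_conv)

text \<open>Below a nonempty sequence there is a singleton with smaller entry, as the rationals have
  no least element. Where the first entries differ, prolonging the smaller sequence works; otherwise
  recurse.\<close>

lemma rat_list_dense: "s < t \<Longrightarrow> \<exists>r. s < r \<and> r < t" for s t :: "rat list"
proof (induction s arbitrary: t)
  case Nil
  then obtain b t' where "t = b # t'" by (cases t) auto
  then show ?case by (intro exI[of _ "[b - 1]"]) simp
next
  case (Cons a s)
  then obtain b t' where t: "t = b # t'" by (cases t) auto
  show ?case
  proof (cases "a < b")
    case True
    then show ?thesis
      using t less_append[of "[0]" s] by (intro exI[of _ "a # s @ [0]"]) simp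
  next
    case False
    then have "a = b" "s < t'" using Cons.prems t by auto
    with Cons.IH obtain r where "s < r" "r < t'" by blast
    then show ?thesis using t \<open>a = b\<close> by (intro exI[of _ "a # r"]) simp
  qed
qed

lemma between_append:
  "s < r \<Longrightarrow> r < s @ u \<Longrightarrow> \<exists>v. v \<noteq> [] \<and> r = s @ v" for s r u :: "'a::linorder list"
proof (induction s arbitrary: r)
  case (Cons a s)
  then show ?case by (cases r) auto
qed auto

lemma less_append_same_length:
  "length s = length t \<Longrightarrow> s < t @ u \<Longrightarrow> s = t \<or> s < t" for s t u :: "'a::linorder list"
  by (induction s t rule: list_induct2) auto

text \<open>Everything between \<open>s\<close> and an extension of \<open>s\<close> properly
  extends \<open>s\<close> and is longer. Conversely, the parent of \<open>t\<close> has the length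
  of \<open>s\<close>; it does not lie between \<open>s\<close> and \<open>t\<close>, which forces
  it to be \<open>s\<close>.\<close>

lemma child_iff:
  fixes s t :: "'a::linorder list"
  shows "(\<exists>q. t = s @ [q]) \<longleftrightarrow>
    length t = Suc (length s) \<and> s < t \<and> \<not> (\<exists>r. s < r \<and> r < t \<and> length r \<le> length s)"
    (is "?L \<longleftrightarrow> ?R")
proof
  assume ?L
  then obtain q where t: "t = s @ [q]" by blast
  have "\<not> length r \<le> length s" if "s < r" "r < t" for r
    using between_append[of s r "[q]"] that t by auto
  then show ?R using t less_append[of "[q]" s] by auto
next
  assume R: ?R
  then obtain t' q where t: "t = t' @ [q]" by (cases t rule: rev_cases) auto
  then have len: "length s = length t'" using R by simp
  have "t' < t" using t less_append[of "[q]" t'] by simp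
  then have "\<not> s < t'" using R len by auto
  then have "s = t'" using less_append_same_length[OF len, of "[q]"] R t by blast
  then show ?L using t by blast
qed

text \<open>\<open>child_iff\<close> describes children by order and length only, both of which are
  preserved. The two claims are the forth and back steps along the tree.\<close>

lemma tree_iso:
  fixes \<Theta> :: "'a::linorder list \<Rightarrow> 'a list"
  assumes bij: "bij \<Theta>" and less: "\<And>s t. \<Theta> s < \<Theta> t \<longleftrightarrow> s < t" and len: "\<And>s. length (\<Theta> s) = length s"
  shows "\<exists>q'. \<Theta> (s @ [q]) = \<Theta> s @ [q']" and "\<exists>q. \<Theta> (s @ [q]) = \<Theta> s @ [q']"
proof -
  have all: "(\<exists>r. P r) \<longleftrightarrow> (\<exists>r. P (\<Theta> r))" for P using bij by (metis bij_pointE)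
  have *: "(\<exists>q. t = s @ [q]) \<longleftrightarrow> (\<exists>q. \<Theta> t = \<Theta> s @ [q])" for t
    unfolding child_iff all[of "\<lambda>r. \<Theta> s < r \<and> r < \<Theta> t \<and> length r \<le> length (\<Theta> s)"]
    by (simp add: less len)
  show "\<exists>q'. \<Theta> (s @ [q]) = \<Theta> s @ [q']" using *[of "s @ [q]"] by blast
  obtain t where t: "\<Theta> t = \<Theta> s @ [q']" using bij by (metis bij_pointE)
  then obtain q where "t = s @ [q]" using *[of t] by blast
  with t show "\<exists>q. \<Theta> (s @ [q]) = \<Theta> s @ [q']" by blast
qed

section \<open>Coding countable structures\<close>

lemma filter_eq_imp: "filter P xs = filter Q xs \<Longrightarrow> x \<in> set xs \<Longrightarrow> P x \<longleftrightarrow> Q x"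
  by (metis (mono_tags, lifting) mem_Collect_eq set_filter)

lemma measurable_filter:
  assumes "\<And>x. x \<in> set xs \<Longrightarrow> Measurable.pred M (\<lambda>A. P A x)"
  shows "(\<lambda>A. filter (P A) xs) \<in> measurable M (count_space UNIV)"
  using assms
proof (induction xs)
  case (Cons x xs)
  have P: "Measurable.pred M (\<lambda>A. P A x)" using Cons.prems by simp
  have xs: "(\<lambda>A. filter (P A) xs) \<in> measurable M (count_space UNIV)"
    using Cons.prems by (intro Cons.IH) simp
  have "(\<lambda>A. x # filter (P A) xs) \<in> measurable M (count_space UNIV)"
    by (rule measurable_compose[OF xs]) simp
  with xs P show ?case by (simp add: measurable_If pred_def)
qed simp

context
  fixes L :: "'s set" and ar :: "'s \<Rightarrow> nat"
begin

section \<open>Codes of finite parts of quantifier-free types\<close>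

definition symbol :: "nat \<Rightarrow> 's" where
  "symbol = from_nat_into L"

text \<open>Atoms are named by the number of a symbol and by places in the tuple. Bounding both by
  \<open>k\<close> keeps the list finite, and as \<open>k\<close> grows every atom eventually
  appears.\<close>

definition atom_indices :: "nat \<Rightarrow> (nat \<times> nat list) list" where
  "atom_indices k = concat (map (\<lambda>j. map (Pair j) (List.n_lists (ar (symbol j)) [0..<k])) [0..<k])"

text \<open>The membership test covers the empty language, for which \<open>symbol\<close> has
  values outside \<open>L\<close>.\<close>

definition atom_holds :: "('s \<times> nat list \<Rightarrow> bool) \<Rightarrow> nat list \<Rightarrow> nat \<times> nat list \<Rightarrow> bool" where
  "atom_holds A u p \<longleftrightarrow> symbol (fst p) \<in> L \<and> A (symbol (fst p), map ((!) u) (snd p))"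

text \<open>The length is recorded so that a label determines the level of its node in the tree.
  Filtering fixed lists keeps exactly the equalities and the atoms that are true.\<close>

definition qf_code :: "('s \<times> nat list \<Rightarrow> bool) \<Rightarrow> nat list \<Rightarrow> nat" where
  "qf_code A u = to_nat (length u,
     filter (\<lambda>(i, i'). u ! i = u ! i') (List.product [0..<length u] [0..<length u]),
     filter (atom_holds A u) (atom_indices (length u)))"

lemma mem_atom_indices:
  "(j, is) \<in> set (atom_indices k) \<longleftrightarrow> j < k \<and> length is = ar (symbol j) \<and> set is \<subseteq> {..<k}"
  by (auto simp: atom_indices_def set_n_lists image_iff atLeast0LessThan)

lemma qf_code_eqD:
  assumes "qf_code A u = qf_code B v"
  shows "length u = length v"
    and "i < length u \<Longrightarrow> i' < length u \<Longrightarrow> u ! i = u ! i' \<longleftrightarrow> v ! i = v ! i'"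
    and "symbol j \<in> L \<Longrightarrow> j < length u \<Longrightarrow> length is = ar (symbol j) \<Longrightarrow> set is \<subseteq> {..<length u} \<Longrightarrow>
      A (symbol j, map ((!) u) is) \<longleftrightarrow> B (symbol j, map ((!) v) is)"
proof -
  show len: "length u = length v" using assms by (simp add: qf_code_def)
  show "u ! i = u ! i' \<longleftrightarrow> v ! i = v ! i'" if "i < length u" "i' < length u"
  proof -
    have "filter (\<lambda>(i, i'). u ! i = u ! i') (List.product [0..<length u] [0..<length u]) =
        filter (\<lambda>(i, i'). v ! i = v ! i') (List.product [0..<length u] [0..<length u])"
      using assms len by (simp add: qf_code_def)
    from filter_eq_imp[OF this, of "(i, i')"] that show ?thesis by simp
  qed
  show "A (symbol j, map ((!) u) is) \<longleftrightarrow> B (symbol j, map ((!) v) is)"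
    if "symbol j \<in> L" "j < length u" "length is = ar (symbol j)" "set is \<subseteq> {..<length u}"
  proof -
    have "filter (atom_holds A u) (atom_indices (length u)) = filter (atom_holds B v) (atom_indices (length u))"
      using assms len by (simp add: qf_code_def)
    from filter_eq_imp[OF this, of "(j, is)"] that show ?thesis
      by (simp add: mem_atom_indices atom_holds_def)
  qed
qed

lemma qf_code_map:
  assumes inj: "inj f" and iso: "\<And>r xs. (r, xs) \<in> atoms L ar \<Longrightarrow> A (r, xs) \<longleftrightarrow> B (r, map f xs)"
  shows "qf_code B (map f u) = qf_code A u"
proof -
  have "filter (\<lambda>(i, i'). map f u ! i = map f u ! i') (List.product [0..<length u] [0..<length u]) =
      filter (\<lambda>(i, i'). u ! i = u ! i') (List.product [0..<length u] [0..<length u])"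
    by (rule filter_cong[OF refl]) (auto simp: inj_eq[OF inj])
  moreover have "filter (atom_holds B (map f u)) (atom_indices (length u)) =
      filter (atom_holds A u) (atom_indices (length u))"
  proof (rule filter_cong[OF refl])
    fix p assume "p \<in> set (atom_indices (length u))"
    moreover obtain j "is" where "p = (j, is)" by (cases p)
    ultimately have p: "p = (j, is)" "length is = ar (symbol j)" "set is \<subseteq> {..<length u}"
      by (simp_all add: mem_atom_indices)
    have eq: "map ((!) (map f u)) is = map f (map ((!) u) is)" using p(3) by auto
    show "atom_holds B (map f u) p \<longleftrightarrow> atom_holds A u p"
      unfolding atom_holds_def p(1) fst_conv snd_conv eq
      using iso[of "symbol j" "map ((!) u) is"] p(2) by (auto simp: atoms_def)
  qed
  ultimately show ?thesis by (simp add: qf_code_def)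
qed

text \<open>A code depends on finitely many atoms only.\<close>

lemma measurable_qf_code:
  "(\<lambda>A. qf_code A u) \<in> measurable (restrict_space (structures L ar) C) (count_space UNIV)"
proof -
  have "(\<lambda>A. filter (atom_holds A u) (atom_indices (length u)))
      \<in> measurable (restrict_space (structures L ar) C) (count_space UNIV)"
  proof (rule measurable_filter)
    fix p assume p: "p \<in> set (atom_indices (length u))"
    show "Measurable.pred (restrict_space (structures L ar) C) (\<lambda>A. atom_holds A u p)"
    proof (cases "symbol (fst p) \<in> L")
      case True
      then have "(symbol (fst p), map ((!) u) (snd p)) \<in> atoms L ar"
        using p by (cases p) (simp add: mem_atom_indices atoms_def)
      from atom_measurable[OF this] show ?thesis
        using True by (simp add: atom_holds_def)
    qed (simp add: atom_holds_def)
  qed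
  then show ?thesis
    unfolding qf_code_def by (rule measurable_compose) simp
qed

text \<open>
  The label of \<open>s\<close> codes the quantifier-free type, with respect to the first \<open>length s\<close> relation
  symbols, of the tuple of natural numbers named by the colours of the entries of \<open>s\<close>.  As every
  colour is dense, the children of a node realise all one-point extensions of its tuple, each of
  them densely often.
\<close>

definition node_label :: "('s \<times> nat list \<Rightarrow> bool) \<Rightarrow> rat list \<Rightarrow> nat" where
  "node_label A s = qf_code A (map dyadic_colour s)"

text \<open>The isomorphism permutes the colours, and an order automorphism of the rationals
  realises this permutation. Applied entrywise to sequences it preserves labels and the
  lexicographic order.\<close>

lemma node_order_of_isomorphism:
  assumes f: "bij f" and iso: "\<forall>(r, xs)\<in>atoms L ar. A (r, xs) \<longleftrightarrow> B (r, map f xs)"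
  shows "order_isomorphic (block_sum (node_label A)) lexless (block_sum (node_label B)) lexless"
proof -
  have A: "dense_coloured (UNIV :: rat set) (<) (\<lambda>q. f (dyadic_colour q)) UNIV"
    by (rule dense_coloured_dyadic) (rule bij_is_surj[OF f])
  have B: "dense_coloured (UNIV :: rat set) (<) dyadic_colour UNIV"
    using dense_coloured_dyadic[of id UNIV] by simp
  \<comment> \<open>Back-and-forth between the rationals coloured through \<open>f\<close> and the
    rationals with their own colours.\<close>
  obtain \<eta> :: "rat \<Rightarrow> rat" where \<eta>: "bij \<eta>" "\<And>q. dyadic_colour (\<eta> q) = f (dyadic_colour q)"
      "\<And>q q'. \<eta> q < \<eta> q' \<longleftrightarrow> q < q'"
    using dense_coloured_isomorphism[OF A B] by auto
  have label: "node_label B (map \<eta> s) = node_label A s" for s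
    using qf_code_map[of f A B "map dyadic_colour s", OF bij_is_inj[OF f]] iso
    by (auto simp: node_label_def comp_def \<eta>(2))
  have inj: "inj \<eta>" using \<eta>(1) by (rule bij_is_inj)
  have less: "map \<eta> s < map \<eta> t \<longleftrightarrow> s < t" for s t
  proof (induction s arbitrary: t)
    case Nil
    then show ?case by (cases t) auto
  next
    case (Cons a s)
    then show ?case using inj by (cases t) (auto simp: \<eta>(3) dest: injD)
  qed
  define \<theta> where "\<theta> = map_prod (map \<eta>) (id :: nat \<Rightarrow> nat)"
  have "bij_betw \<theta> (block_sum (node_label A)) (block_sum (node_label B))"
  proof (rule bij_betw_imageI)
    show "inj_on \<theta> (block_sum (node_label A))"
      using inj by (auto simp: \<theta>_def inj_on_def inj_map_eq_map)
    show "\<theta> ` block_sum (node_label A) = block_sum (node_label B)"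
    proof
      show "\<theta> ` block_sum (node_label A) \<subseteq> block_sum (node_label B)"
        by (auto simp: \<theta>_def block_sum_def label)
      show "block_sum (node_label B) \<subseteq> \<theta> ` block_sum (node_label A)"
      proof
        fix p assume p: "p \<in> block_sum (node_label B)"
        obtain s where s: "fst p = map \<eta> s"
          using bij_is_surj[OF \<eta>(1)] by (metis ex_map_conv surjD)
        then have "(s, snd p) \<in> block_sum (node_label A)" using p label[of s] by (auto simp: block_sum_def)
        then show "p \<in> \<theta> ` block_sum (node_label A)"
          by (rule rev_image_eqI) (simp add: \<theta>_def s[symmetric])
      qed
    qed
  qed
  moreover have "lexless p q \<longleftrightarrow> lexless (\<theta> p) (\<theta> q)" for p q
    by (simp add: \<theta>_def lexless_def less inj_map_eq_map[OF inj])
  ultimately show ?thesis unfolding order_isomorphic_def by blast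
qed

text \<open>
  A label preserving isomorphism of the trees matches up the children of any two corresponding
  nodes, so it gives a back-and-forth system between the structures.
\<close>

lemma isomorphism_of_node_order:
  assumes L: "countable L"
    and iso: "order_isomorphic (block_sum (node_label A)) lexless (block_sum (node_label B)) lexless"
  shows "\<exists>f. bij f \<and> (\<forall>(r, xs)\<in>atoms L ar. A (r, xs) \<longleftrightarrow> B (r, map f xs))"
proof -
  obtain \<Theta> where \<Theta>: "bij \<Theta>" "\<And>s t. \<Theta> s < \<Theta> t \<longleftrightarrow> s < t" "\<And>s. node_label B (\<Theta> s) = node_label A s"
    using block_sum_iso[OF rat_list_dense iso] by blast
  let ?c = dyadic_colour
  have code: "qf_code A (map ?c s) = qf_code B (map ?c (\<Theta> s))" for s
    using \<Theta>(3) by (simp add: node_label_def)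
  have len: "length (\<Theta> s) = length s" for s
    using qf_code_eqD(1)[OF code[of s]] by simp
  note children = tree_iso[OF \<Theta>(1,2) len]
  have colour: "\<exists>q. ?c q = k" for k
    using dyadic_colour_dense[of 0 1 k] by auto
  \<comment> \<open>The matching of elements given by a node and its image. It is reversed because
    children append an entry at the end while back-and-forth adds pairs at the front.\<close>
  define P where "P s = rev (zip (map ?c s) (map ?c (\<Theta> s)))" for s
  have P_snoc: "P (s @ [q]) = (?c q, ?c q') # P s" if "\<Theta> (s @ [q]) = \<Theta> s @ [q']" for s q q'
    by (simp add: P_def that len)
  have P_mem: "(a, b) \<in> set (P s) \<longleftrightarrow> (\<exists>i<length s. a = map ?c s ! i \<and> b = map ?c (\<Theta> s) ! i)" for s a b
    by (auto simp: P_def set_zip len)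
  have P_inj: "a = a' \<longleftrightarrow> b = b'" if "(a, b) \<in> set (P s)" "(a', b') \<in> set (P s)" for s a b a' b'
    using that qf_code_eqD(2)[OF code[of s]] unfolding P_mem by auto
  show ?thesis
  proof (rule back_and_forth_measurable[where M = "count_space (UNIV :: unit set)" and
        A = "\<lambda>_. UNIV" and B = UNIV and G = "\<lambda>_ p. p \<in> range P"])
    show "[] \<in> range P"
      using len[of "[]"] by (intro range_eqI[of _ _ "[]"]) (simp add: P_def)
    show "\<exists>b. (a, b) # p \<in> range P" if p: "p \<in> range P" for a p
    proof -
      obtain s where s: "p = P s" using p by blast
      obtain q q' where q: "?c q = a" "\<Theta> (s @ [q]) = \<Theta> s @ [q']"
        using colour children(1) by metis
      then have "(a, ?c q') # p = P (s @ [q])" using P_snoc s by simp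
      then show ?thesis by blast
    qed
    show "\<exists>a. (a, b) # p \<in> range P" if p: "p \<in> range P" for b p
    proof -
      obtain s where s: "p = P s" using p by blast
      obtain q q' where q: "?c q' = b" "\<Theta> (s @ [q]) = \<Theta> s @ [q']"
        using colour children(2) by metis
      then have "(?c q, b) # p = P (s @ [q])" using P_snoc s by simp
      then show ?thesis by blast
    qed
    show "a = a' \<longleftrightarrow> b = b'" if "p \<in> range P" "(a, b) \<in> set p" "(a', b') \<in> set p" for p a b a' b'
      using that P_inj by blast
  next
    fix F :: "unit \<Rightarrow> nat \<Rightarrow> nat"
    assume bij: "\<And>x. x \<in> space (count_space UNIV) \<Longrightarrow> bij (F x)"
      and fin: "\<And>x as. x \<in> space (count_space UNIV) \<Longrightarrow> finite as \<Longrightarrow> as \<subseteq> UNIV \<Longrightarrow>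
        \<exists>p. p \<in> range P \<and> (\<forall>a\<in>as. (a, F x a) \<in> set p)"
    define f where "f = F ()"
    have "A (r, xs) \<longleftrightarrow> B (r, map f xs)" if rx: "(r, xs) \<in> atoms L ar" for r xs
    proof -
      have r: "r \<in> L" "length xs = ar r" using rx by (auto simp: atoms_def)
      then obtain j where j: "symbol j = r"
        using from_nat_into_surj[OF L] unfolding symbol_def by blast
      \<comment> \<open>Matching \<open>0, ..., j\<close> as well forces \<open>s\<close> to have
        more than \<open>j\<close> entries, so its label takes the symbol number \<open>j\<close>
        into account.\<close>
      obtain s where s: "\<And>a. a \<in> set xs \<union> {..j} \<Longrightarrow> (a, f a) \<in> set (P s)"
        using fin[of "()" "set xs \<union> {..j}"] unfolding f_def by auto
      have "{..j} \<subseteq> set (map ?c s)"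
        using s unfolding P_mem by (fastforce simp: in_set_conv_nth)
      then have "card {..j} \<le> card (set (map ?c s))" by (intro card_mono) auto
      then have len_s: "j < length (map ?c s)" using card_length[of "map ?c s"] by simp
      have "\<forall>a\<in>set xs. \<exists>i<length s. a = map ?c s ! i \<and> f a = map ?c (\<Theta> s) ! i"
        using s unfolding P_mem by blast
      then obtain i where i: "\<And>a. a \<in> set xs \<Longrightarrow> i a < length s \<and> a = map ?c s ! i a \<and> f a = map ?c (\<Theta> s) ! i a"
        by metis
      define "is" where "is = map i xs"
      have "map ((!) (map ?c s)) is = xs"
        unfolding is_def map_map by (rule map_idI) (use i in \<open>metis comp_apply\<close>)
      moreover have "map ((!) (map ?c (\<Theta> s))) is = map f xs"
        unfolding is_def map_map by (rule map_cong[OF refl]) (use i in \<open>metis comp_apply\<close>)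
      moreover have "A (symbol j, map ((!) (map ?c s)) is) \<longleftrightarrow> B (symbol j, map ((!) (map ?c (\<Theta> s))) is)"
        by (rule qf_code_eqD(3)[OF code[of s]]) (use r j len_s i in \<open>auto simp: is_def\<close>)
      ultimately show ?thesis using j by simp
    qed
    moreover have "bij f" using bij by (simp add: f_def)
    ultimately show ?thesis by blast
  qed simp_all
qed

text \<open>The order relation on pairs is fixed; only the set of pairs varies with the structure,
  and membership in it is a comparison with a label.\<close>

lemma structures_reduce_to_conjugacy:
  assumes D: "generic_dense_set D" and n: "2 \<le> n" and L: "countable L"
  shows "borel_reducible (restrict_space (structures L ar) C) (isomorphism L ar C)
    (Aut_S_space D n) (conjugacy (Aut_S D n))"
proof -
  let ?M = "restrict_space (structures L ar) C"
  have "\<exists>f\<in>measurable ?M (Aut_S_space D n). \<forall>A\<in>space ?M. \<forall>B\<in>space ?M.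
      (f A, f B) \<in> conjugacy (Aut_S D n) \<longleftrightarrow>
      order_isomorphic (block_sum (node_label A)) lexless (block_sum (node_label B)) lexless"
  proof (rule orders_reduce_to_conjugacy[OF D n])
    show "Measurable.pred ?M (\<lambda>A. p \<in> block_sum (node_label A))" for p
    proof -
      have [measurable]: "(\<lambda>A. node_label A (fst p)) \<in> measurable ?M (count_space UNIV)"
        unfolding node_label_def by (rule measurable_qf_code)
      have "Measurable.pred ?M (\<lambda>A. snd p \<le> node_label A (fst p))" by measurable
      then show ?thesis by (simp add: block_sum_def split_def)
    qed
  qed (simp_all add: strict_linear_on_lexless)
  moreover have "(A, B) \<in> isomorphism L ar C \<longleftrightarrow>
      order_isomorphic (block_sum (node_label A)) lexless (block_sum (node_label B)) lexless"
    if "A \<in> space ?M" "B \<in> space ?M" for A B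
  proof -
    have "A \<in> C" "B \<in> C" using that by (auto simp: space_restrict_space)
    then show ?thesis
      using node_order_of_isomorphism[of _ A B] isomorphism_of_node_order[OF L, of A B]
      unfolding isomorphism_def by blast
  qed
  ultimately show ?thesis
    unfolding borel_reducible_def by blast
qed

end

theorem theorem2p4:
  fixes D :: "complex set" and n :: nat
  assumes "generic_dense_set D" and "n \<ge> 2"
  shows "borel_reducible linear_order_space linear_order_isomorphism
           (Aut_S_space D n) (conjugacy (Aut_S D n))
         \<and> borel_complete TYPE('s) (Aut_S_space D n) (conjugacy (Aut_S D n))"
  using assms linear_orders_reduce_to_conjugacy structures_reduce_to_conjugacy
  unfolding borel_complete_def by blast

end
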